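(* If $\mathsf{A}$ is a perfect algebra with bracket (AWB), then the homomorphism $\psi_{\mathsf{A}}:\mathsf{A}\boxtimes\mathsf{A}\to\mathsf{A}$, given on generators by $\psi_{\mathsf{A}}(a\odot a')=aa'$ and $\psi_{\mathsf{A}}(a\circledast a')=[a,a']$, is the universal central extension of $\mathsf{A}$, where $\mathsf{A}\boxtimes\mathsf{A}$ is the non-abelian tensor product with respect to the actions of $\mathsf{A}$ on itself given by its own operations.
   Context: All vector spaces and algebras are over a fixed field $\mathbb{K}$. An algebra with bracket (AWB) is an associative, not necessarily commutative (and not necessarily unital) algebra $\mathsf{A}$ with a bilinear map $[-,-]:\mathsf{A}\times\mathsf{A}\to\mathsf{A}$ such that $[ab,c]=[a,c]b+a[b,c]$ for all $a,b,c$. Homomorphisms preserve product and bracket. A two-sided ideal is a subspace $\mathsf{B}$ with $\mathsf{A}\mathsf{B},\mathsf{B}\mathsf{A},[\mathsf{A},\mathsf{B}],[\mathsf{B},\mathsf{A}]\subseteq\mathsf{B}$. $[[\mathsf{A},\mathsf{A}]]$ is the two-sided ideal generated by all $aa'$, $[a,a']$; $\mathsf{A}$ is perfect if $\mathsf{A}=[[\mathsf{A},\mathsf{A}]]$. The center is $\mathcal{Z}(\mathsf{A})=\{a: ab=0=ba,\ [a,b]=0=[b,a]\ \forall b\in\mathsf{A}\}$. A central extension of $\mathsf{A}$ is an exact sequence of AWBs $0\to\mathsf{M}\to\mathsf{B}\xrightarrow{\phi}\mathsf{A}\to0$ with $\mathsf{M}\subseteq\mathcal{Z}(\mathsf{B})$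 (we also call $\phi$ a central extension). It is universal if for every central extension $0\to\mathsf{N}\to\mathsf{C}\xrightarrow{\psi}\mathsf{A}\to0$ there is a unique homomorphism of AWBs $\alpha:\mathsf{B}\to\mathsf{C}$ with $\psi\circ\alpha=\phi$. Non-abelian tensor product. In general it is defined for AWBs $\mathsf{M},\mathsf{N}$ with compatible mutual actions ${}^{m\cdot}n$, $n^{\cdot m}$, ${}^{m\ast}n$, $n^{\ast m}\in\mathsf{N}$ and ${}^{n\cdot}m$, $m^{\cdot n}$, ${}^{n\ast}m$, $m^{\ast n}\in\mathsf{M}$; here $\mathsf{M}=\mathsf{N}=\mathsf{A}$ and the actions are ${}^{x\cdot}y=xy$, $y^{\cdot x}=yx$, ${}^{x\ast}y=[x,y]$, $y^{\ast x}=[y,x]$, which are compatible. Call a pair $(u_{\mathsf{M}},u_{\mathsf{N}})\in\mathsf{M}\times\mathsf{N}$ basic if it is one of $(m^{\cdot n},{}^{m\cdot}n)$, $({}^{n\cdot}m,n^{\cdot m})$, $(m^{\ast n},{}^{m\ast}n)$, $({}^{n\ast}m,n^{\ast m})$ for some $m\in\mathsf{M}$, $n\in\mathsf{N}$. Then $\mathsf{M}\boxtimes\mathsf{N}$ is the vector space spanned by formal symbols $m\odot n$, $n\odot m$, $m\circledast n$, $n\circledast m$ for $m\in\mathsf{M}$, $n\in\mathsf{N}$ (four formally distinct families, also when $\mathsf{M}$ and $\mathsf{N}$ have elements in common or are equal, $\mathsf{M}$ and $\mathsf{N}$ then being regarded as two copies), modulo the following relations, for all $\lambda\in\mathbb{K}$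 and all elements, where $\star$ stands for either of $\odot$, $\circledast$: (1) $\lambda(m\star n)=(\lambda m)\star n=m\star(\lambda n)$, $(m+m')\star n=m\star n+m'\star n$, $m\star(n+n')=m\star n+m\star n'$; (2) $u_{\mathsf{M}}\star v_{\mathsf{N}}=u_{\mathsf{N}}\star v_{\mathsf{M}}$ for all basic pairs $(u_{\mathsf{M}},u_{\mathsf{N}})$, $(v_{\mathsf{M}},v_{\mathsf{N}})$; (3) $(m_1m_2)\odot n=m_1\odot({}^{m_2\cdot}n)$; $\ n\odot(m_1m_2)=(n^{\cdot m_1})\odot m_2$; $\ (m_1m_2)\circledast n=m_1\odot({}^{m_2\ast}n)+({}^{m_1\ast}n)\odot m_2$; $\ ({}^{m_1\cdot}n)\circledast m_2=m_1\odot(n^{\ast m_2})+[m_1,m_2]\odot n$; $\ (n^{\cdot m_1})\circledast m_2=(n^{\ast m_2})\odot m_1+n\odot[m_1,m_2]$; $\ ({}^{m_1\cdot}n)\odot m_2=m_1\odot(n^{\cdot m_2})$; (4) all relations obtained from (1) and (3) by exchanging the roles of elements of $\mathsf{M}$ and $\mathsf{N}$. To each generator $g$ associate a basic pair $(g_{\mathsf{M}},g_{\mathsf{N}})$: $m\odot n\mapsto(m^{\cdot n},{}^{m\cdot}n)$, $n\odot m\mapsto({}^{n\cdot}m,n^{\cdot m})$, $m\circledast n\mapsto(m^{\ast n},{}^{m\ast}n)$, $n\circledast m\mapsto({}^{n\ast}m,n^{\ast m})$. The AWB structure on $\mathsf{M}\boxtimes\mathsf{N}$ is given on generators by $g\,h=g_{\mathsf{M}}\odot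 h_{\mathsf{N}}$ and $[g,h]=g_{\mathsf{M}}\circledast h_{\mathsf{N}}$. The map $\psi_{\mathsf{M}}:\mathsf{M}\boxtimes\mathsf{N}\to\mathsf{M}$, $g\mapsto g_{\mathsf{M}}$, is a well-defined AWB homomorphism; for $\mathsf{M}=\mathsf{N}=\mathsf{A}$ it is $\psi_{\mathsf{A}}$, sending any generator $x\odot y$ to $xy$ and any generator $x\circledast y$ to $[x,y]$. *)

theory Defs
  imports "HOL.Hull" "HOL-Algebra.Module" "HOL-Algebra.QuotRing"
begin

section \<open>Algebras with bracket\<close>

text \<open>
  The product of an algebra with bracket is the field \<open>mult\<close> inherited from \<^typ>\<open>('k, 'a) module\<close>.
  The inherited field \<open>one\<close> carries no meaning: algebras are not assumed unital, and no definition
  below refers to the unit of an algebra (only to that of the ground field).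
\<close>

record ('k, 'a) awb = "('k, 'a) module" +
  bracket :: "'a \<Rightarrow> 'a \<Rightarrow> 'a"

definition bilinear_op ::
    "('k, 'e) ring_scheme \<Rightarrow> ('k, 'a, 'z) module_scheme \<Rightarrow> ('a \<Rightarrow> 'a \<Rightarrow> 'a) \<Rightarrow> bool" where
  "bilinear_op K A f \<longleftrightarrow>
     (\<forall>x\<in>carrier A. \<forall>y\<in>carrier A. f x y \<in> carrier A) \<and>
     (\<forall>x\<in>carrier A. \<forall>y\<in>carrier A. \<forall>z\<in>carrier A.
        f (x \<oplus>\<^bsub>A\<^esub> y) z = f x z \<oplus>\<^bsub>A\<^esub> f y z \<and> f z (x \<oplus>\<^bsub>A\<^esub> y) = f z x \<oplus>\<^bsub>A\<^esub> f z y) \<and>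
     (\<forall>c\<in>carrier K. \<forall>x\<in>carrier A. \<forall>y\<in>carrier A.
        f (c \<odot>\<^bsub>A\<^esub> x) y = c \<odot>\<^bsub>A\<^esub> f x y \<and> f x (c \<odot>\<^bsub>A\<^esub> y) = c \<odot>\<^bsub>A\<^esub> f x y)"

locale awb = K?: field K + A?: module K A
  for K :: "('k, 'e) ring_scheme" (structure) and A :: "('k, 'a) awb" (structure) +
  assumes mult_bilinear: "bilinear_op K A (\<otimes>\<^bsub>A\<^esub>)"
    and mult_assoc: "\<lbrakk>x \<in> carrier A; y \<in> carrier A; z \<in> carrier A\<rbrakk>
      \<Longrightarrow> (x \<otimes>\<^bsub>A\<^esub> y) \<otimes>\<^bsub>A\<^esub> z = x \<otimes>\<^bsub>A\<^esub> (y \<otimes>\<^bsub>A\<^esub> z)"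
    and bracket_bilinear: "bilinear_op K A (bracket A)"
    and bracket_mult: "\<lbrakk>a \<in> carrier A; b \<in> carrier A; c \<in> carrier A\<rbrakk>
      \<Longrightarrow> bracket A (a \<otimes>\<^bsub>A\<^esub> b) c
          = (bracket A a c \<otimes>\<^bsub>A\<^esub> b) \<oplus>\<^bsub>A\<^esub> (a \<otimes>\<^bsub>A\<^esub> bracket A b c)"

definition awb_hom ::
    "('k, 'e) ring_scheme \<Rightarrow> ('k, 'a) awb \<Rightarrow> ('k, 'b) awb \<Rightarrow> ('a \<Rightarrow> 'b) set" where
  "awb_hom K A B = {f. f \<in> carrier A \<rightarrow> carrier B \<and>
     (\<forall>x\<in>carrier A. \<forall>y\<in>carrier A. f (x \<oplus>\<^bsub>A\<^esub> y) = f x \<oplus>\<^bsub>B\<^esub> f y) \<and>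
     (\<forall>c\<in>carrier K. \<forall>x\<in>carrier A. f (c \<odot>\<^bsub>A\<^esub> x) = c \<odot>\<^bsub>B\<^esub> f x) \<and>
     (\<forall>x\<in>carrier A. \<forall>y\<in>carrier A. f (x \<otimes>\<^bsub>A\<^esub> y) = f x \<otimes>\<^bsub>B\<^esub> f y) \<and>
     (\<forall>x\<in>carrier A. \<forall>y\<in>carrier A. f (bracket A x y) = bracket B (f x) (f y))}"

definition awb_ideal :: "('k, 'e) ring_scheme \<Rightarrow> ('k, 'a) awb \<Rightarrow> 'a set \<Rightarrow> bool" where
  "awb_ideal K A I \<longleftrightarrow> submodule I K A \<and>
     (\<forall>a\<in>carrier A. \<forall>b\<in>I. a \<otimes>\<^bsub>A\<^esub> b \<in> I \<and> b \<otimes>\<^bsub>A\<^esub> a \<in> I \<and> bracket A a b \<in> I \<and> bracket A b a \<in> I)"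

definition commutator_ideal :: "('k, 'e) ring_scheme \<Rightarrow> ('k, 'a) awb \<Rightarrow> 'a set" where
  "commutator_ideal K A = awb_ideal K A hull
     ({a \<otimes>\<^bsub>A\<^esub> a' | a a'. a \<in> carrier A \<and> a' \<in> carrier A} \<union>
      {bracket A a a' | a a'. a \<in> carrier A \<and> a' \<in> carrier A})"

definition perfect_awb :: "('k, 'e) ring_scheme \<Rightarrow> ('k, 'a) awb \<Rightarrow> bool" where
  "perfect_awb K A \<longleftrightarrow> carrier A = commutator_ideal K A"

definition awb_center :: "('k, 'a) awb \<Rightarrow> 'a set" where
  "awb_center A = {a \<in> carrier A. \<forall>b\<in>carrier A.
     a \<otimes>\<^bsub>A\<^esub> b = \<zero>\<^bsub>A\<^esub> \<and> b \<otimes>\<^bsub>A\<^esub> a = \<zero>\<^bsub>A\<^esub> \<and> bracket A a b = \<zero>\<^bsub>A\<^esub> \<and> bracket A b a = \<zero>\<^bsub>A\<^esub>}"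

section \<open>Universal central extensions\<close>

text \<open>
  A central extension \<open>0 \<rightarrow> M \<rightarrow> B \<rightarrow> A \<rightarrow> 0\<close> with \<open>M \<subseteq> Z(B)\<close> is represented by its map
  \<open>\<phi> : B \<rightarrow> A\<close>: exactness says that \<open>\<phi>\<close> is onto and that \<open>M\<close> is the kernel of \<open>\<phi>\<close>.
\<close>

definition central_extension ::
    "('k, 'e) ring_scheme \<Rightarrow> ('k, 'b) awb \<Rightarrow> ('k, 'a) awb \<Rightarrow> ('b \<Rightarrow> 'a) \<Rightarrow> bool" where
  "central_extension K B A \<phi> \<longleftrightarrow> awb K B \<and> awb K A \<and> \<phi> \<in> awb_hom K B A \<and>
     \<phi> ` carrier B = carrier A \<and> a_kernel B A \<phi> \<subseteq> awb_center B"

text \<open>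
  The competing extensions \<open>C\<close> range over all algebras with bracket whose carrier is a subset of the
  type \<open>'c\<close>; a theorem in which \<open>'c\<close> is a free type variable thus covers all of them.
  Homomorphisms out of \<open>B\<close> only matter on the carrier of \<open>B\<close>, so uniqueness is expressed for
  extensional functions.
\<close>

definition universal_central_extension ::
    "'c itself \<Rightarrow> ('k, 'e) ring_scheme \<Rightarrow> ('k, 'b) awb \<Rightarrow> ('k, 'a) awb \<Rightarrow> ('b \<Rightarrow> 'a) \<Rightarrow> bool" where
  "universal_central_extension (_ :: 'c itself) K B A \<phi> \<longleftrightarrow> central_extension K B A \<phi> \<and>
     (\<forall>(C :: ('k, 'c) awb) \<psi>. central_extension K C A \<psi> \<longrightarrow>
        (\<exists>!\<alpha>. \<alpha> \<in> awb_hom K B C \<inter> extensional (carrier B) \<and>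
              (\<forall>x\<in>carrier B. \<psi> (\<alpha> x) = \<phi> x)))"

section \<open>Free vector spaces\<close>

text \<open>Finitely supported functions \<open>S \<rightarrow> K\<close>, extended by zero; the ring fields \<open>mult\<close> and \<open>one\<close> are
  irrelevant for the vector space structure.\<close>

definition free_space :: "('k, 'e) ring_scheme \<Rightarrow> 's set \<Rightarrow> ('k, 's \<Rightarrow> 'k) module" where
  "free_space K S =
     \<lparr>carrier = {p. (\<forall>s\<in>S. p s \<in> carrier K) \<and> (\<forall>s. s \<notin> S \<longrightarrow> p s = \<zero>\<^bsub>K\<^esub>) \<and>
                    finite {s. p s \<noteq> \<zero>\<^bsub>K\<^esub>}},
      mult = undefined, one = undefined,
      zero = (\<lambda>_. \<zero>\<^bsub>K\<^esub>), add = (\<lambda>p q s. p s \<oplus>\<^bsub>K\<^esub> q s),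
      smult = (\<lambda>c p s. c \<otimes>\<^bsub>K\<^esub> p s)\<rparr>"

definition basis_vec :: "('k, 'e) ring_scheme \<Rightarrow> 's \<Rightarrow> 's \<Rightarrow> 'k" where
  "basis_vec K g = (\<lambda>s. if s = g then \<one>\<^bsub>K\<^esub> else \<zero>\<^bsub>K\<^esub>)"

text \<open>The linear map from a free space to \<open>V\<close> with value \<open>u g\<close> on the basis vector of \<open>g\<close>.\<close>

definition lin_ext ::
    "('k, 'e) ring_scheme \<Rightarrow> ('k, 'v, 'z) module_scheme \<Rightarrow> ('s \<Rightarrow> 'v) \<Rightarrow> ('s \<Rightarrow> 'k) \<Rightarrow> 'v" where
  "lin_ext K V u p = (\<Oplus>\<^bsub>V\<^esub> g \<in> {g. p g \<noteq> \<zero>\<^bsub>K\<^esub>}. p g \<odot>\<^bsub>V\<^esub> u g)"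

section \<open>Non-abelian tensor product\<close>

text \<open>
  An action of \<open>X\<close> on \<open>Y\<close>, for \<open>x\<close> in \<open>X\<close> and \<open>y\<close> in \<open>Y\<close>: the four maps send \<open>x, y\<close> to
  \<open>\<^sup>x\<^sup>\<cdot>y\<close> (\<open>ldot x y\<close>), \<open>y\<^sup>\<cdot>\<^sup>x\<close> (\<open>rdot y x\<close>), \<open>\<^sup>x\<^sup>*y\<close> (\<open>lstar x y\<close>) and \<open>y\<^sup>*\<^sup>x\<close> (\<open>rstar y x\<close>).
\<close>

record ('x, 'y) awb_action =
  ldot :: "'x \<Rightarrow> 'y \<Rightarrow> 'y"
  rdot :: "'y \<Rightarrow> 'x \<Rightarrow> 'y"
  lstar :: "'x \<Rightarrow> 'y \<Rightarrow> 'y"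
  rstar :: "'y \<Rightarrow> 'x \<Rightarrow> 'y"

definition self_action :: "('k, 'a) awb \<Rightarrow> ('a, 'a) awb_action" where
  "self_action A = \<lparr>ldot = (\<otimes>\<^bsub>A\<^esub>), rdot = (\<otimes>\<^bsub>A\<^esub>), lstar = bracket A, rstar = bracket A\<rparr>"

text \<open>
  The formal symbols: \<open>MN Odot m n\<close>, \<open>NM Odot n m\<close>, \<open>MN Oast m n\<close>, \<open>NM Oast n m\<close> stand for
  \<open>m \<odot> n\<close>, \<open>n \<odot> m\<close>, \<open>m \<circledast> n\<close>, \<open>n \<circledast> m\<close>. They remain distinct also if \<open>M = N\<close>.
\<close>

datatype tensor_op = Odot | Oast

datatype ('m, 'n) tensor_gen = MN tensor_op 'm 'n | NM tensor_op 'n 'm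

definition tensor_gens :: "('k, 'm) awb \<Rightarrow> ('k, 'n) awb \<Rightarrow> ('m, 'n) tensor_gen set" where
  "tensor_gens M N = {MN s m n | s m n. m \<in> carrier M \<and> n \<in> carrier N} \<union>
                     {NM s n m | s m n. m \<in> carrier M \<and> n \<in> carrier N}"

text \<open>
  The basic pair \<open>(g\<^sub>M, g\<^sub>N)\<close> of a generator \<open>g\<close>. Here and below \<open>P\<close> is the action of \<open>M\<close> on \<open>N\<close>
  and \<open>Q\<close> the action of \<open>N\<close> on \<open>M\<close>.
\<close>

fun gen_fst :: "('n, 'm) awb_action \<Rightarrow> ('m, 'n) tensor_gen \<Rightarrow> 'm" where
  "gen_fst Q (MN Odot m n) = rdot Q m n"
| "gen_fst Q (NM Odot n m) = ldot Q n m"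
| "gen_fst Q (MN Oast m n) = rstar Q m n"
| "gen_fst Q (NM Oast n m) = lstar Q n m"

fun gen_snd :: "('m, 'n) awb_action \<Rightarrow> ('m, 'n) tensor_gen \<Rightarrow> 'n" where
  "gen_snd P (MN Odot m n) = ldot P m n"
| "gen_snd P (NM Odot n m) = rdot P n m"
| "gen_snd P (MN Oast m n) = lstar P m n"
| "gen_snd P (NM Oast n m) = rstar P n m"

definition basic_pairs ::
    "('k, 'm) awb \<Rightarrow> ('k, 'n) awb \<Rightarrow> ('m, 'n) awb_action \<Rightarrow> ('n, 'm) awb_action \<Rightarrow> ('m \<times> 'n) set" where
  "basic_pairs M N P Q = (\<lambda>g. (gen_fst Q g, gen_snd P g)) ` tensor_gens M N"

text \<open>
  The bilinearity relations and the relations involving the operations of \<open>X\<close> and its action \<open>P\<close>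
  on \<open>Y\<close>, as pairs \<open>l\<close>, \<open>r\<close> of elements of \<open>F\<close> that are to be identified. The symbols \<open>x \<star> y\<close> and \<open>y \<star> x\<close> are
  \<open>xy \<star> x y\<close> and \<open>yx \<star> y x\<close>. The relation is used for \<open>(X, Y) = (M, N)\<close> and for
  \<open>(X, Y) = (N, M)\<close>, which exchanges the roles of \<open>M\<close> and \<open>N\<close>.
\<close>

inductive tensor_rel ::
    "('k, 'e) ring_scheme \<Rightarrow> ('k, 'f) module \<Rightarrow> ('k, 'x) awb \<Rightarrow> ('k, 'y) awb \<Rightarrow>
     ('x, 'y) awb_action \<Rightarrow> (tensor_op \<Rightarrow> 'x \<Rightarrow> 'y \<Rightarrow> 'f) \<Rightarrow> (tensor_op \<Rightarrow> 'y \<Rightarrow> 'x \<Rightarrow> 'f) \<Rightarrow>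
     'f \<Rightarrow> 'f \<Rightarrow> bool"
  for K F X Y P xy yx
where
  smult_left: "\<lbrakk>c \<in> carrier K; x \<in> carrier X; y \<in> carrier Y\<rbrakk> \<Longrightarrow>
    tensor_rel K F X Y P xy yx (c \<odot>\<^bsub>F\<^esub> xy s x y) (xy s (c \<odot>\<^bsub>X\<^esub> x) y)"
| smult_right: "\<lbrakk>c \<in> carrier K; x \<in> carrier X; y \<in> carrier Y\<rbrakk> \<Longrightarrow>
    tensor_rel K F X Y P xy yx (c \<odot>\<^bsub>F\<^esub> xy s x y) (xy s x (c \<odot>\<^bsub>Y\<^esub> y))"
| add_left: "\<lbrakk>x \<in> carrier X; x' \<in> carrier X; y \<in> carrier Y\<rbrakk> \<Longrightarrow>
    tensor_rel K F X Y P xy yx (xy s (x \<oplus>\<^bsub>X\<^esub> x') y) (xy s x y \<oplus>\<^bsub>F\<^esub> xy s x' y)"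
| add_right: "\<lbrakk>x \<in> carrier X; y \<in> carrier Y; y' \<in> carrier Y\<rbrakk> \<Longrightarrow>
    tensor_rel K F X Y P xy yx (xy s x (y \<oplus>\<^bsub>Y\<^esub> y')) (xy s x y \<oplus>\<^bsub>F\<^esub> xy s x y')"
| mult_odot: "\<lbrakk>x1 \<in> carrier X; x2 \<in> carrier X; y \<in> carrier Y\<rbrakk> \<Longrightarrow>
    tensor_rel K F X Y P xy yx
      (xy Odot (x1 \<otimes>\<^bsub>X\<^esub> x2) y)
      (xy Odot x1 (ldot P x2 y))"
| odot_mult: "\<lbrakk>x1 \<in> carrier X; x2 \<in> carrier X; y \<in> carrier Y\<rbrakk> \<Longrightarrow>
    tensor_rel K F X Y P xy yx
      (yx Odot y (x1 \<otimes>\<^bsub>X\<^esub> x2))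
      (yx Odot (rdot P y x1) x2)"
| mult_oast: "\<lbrakk>x1 \<in> carrier X; x2 \<in> carrier X; y \<in> carrier Y\<rbrakk> \<Longrightarrow>
    tensor_rel K F X Y P xy yx
      (xy Oast (x1 \<otimes>\<^bsub>X\<^esub> x2) y)
      (xy Odot x1 (lstar P x2 y) \<oplus>\<^bsub>F\<^esub> yx Odot (lstar P x1 y) x2)"
| ldot_oast: "\<lbrakk>x1 \<in> carrier X; x2 \<in> carrier X; y \<in> carrier Y\<rbrakk> \<Longrightarrow>
    tensor_rel K F X Y P xy yx
      (yx Oast (ldot P x1 y) x2)
      (xy Odot x1 (rstar P y x2) \<oplus>\<^bsub>F\<^esub> xy Odot (bracket X x1 x2) y)"
| rdot_oast: "\<lbrakk>x1 \<in> carrier X; x2 \<in> carrier X; y \<in> carrier Y\<rbrakk> \<Longrightarrow>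
    tensor_rel K F X Y P xy yx
      (yx Oast (rdot P y x1) x2)
      (yx Odot (rstar P y x2) x1 \<oplus>\<^bsub>F\<^esub> yx Odot y (bracket X x1 x2))"
| ldot_odot: "\<lbrakk>x1 \<in> carrier X; x2 \<in> carrier X; y \<in> carrier Y\<rbrakk> \<Longrightarrow>
    tensor_rel K F X Y P xy yx
      (yx Odot (ldot P x1 y) x2)
      (xy Odot x1 (rdot P y x2))"

definition tensor_free ::
    "('k, 'e) ring_scheme \<Rightarrow> ('k, 'm) awb \<Rightarrow> ('k, 'n) awb \<Rightarrow> ('k, ('m, 'n) tensor_gen \<Rightarrow> 'k) module"
  where "tensor_free K M N = free_space K (tensor_gens M N)"

definition tensor_relators ::
    "('k, 'e) ring_scheme \<Rightarrow> ('k, 'm) awb \<Rightarrow> ('k, 'n) awb \<Rightarrow>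
     ('m, 'n) awb_action \<Rightarrow> ('n, 'm) awb_action \<Rightarrow> (('m, 'n) tensor_gen \<Rightarrow> 'k) set" where
  "tensor_relators K M N P Q =
     (let F = tensor_free K M N;
          mn = (\<lambda>s m n. basis_vec K (MN s m n));
          nm = (\<lambda>s n m. basis_vec K (NM s n m))
      in {l \<ominus>\<^bsub>F\<^esub> r | l r. tensor_rel K F M N P mn nm l r} \<union>
         {l \<ominus>\<^bsub>F\<^esub> r | l r. tensor_rel K F N M Q nm mn l r} \<union>
         {mn s uM vN \<ominus>\<^bsub>F\<^esub> nm s uN vM | s uM uN vM vN.
            (uM, uN) \<in> basic_pairs M N P Q \<and> (vM, vN) \<in> basic_pairs M N P Q})"

definition tensor_relspace ::
    "('k, 'e) ring_scheme \<Rightarrow> ('k, 'm) awb \<Rightarrow> ('k, 'n) awb \<Rightarrow>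
     ('m, 'n) awb_action \<Rightarrow> ('n, 'm) awb_action \<Rightarrow> (('m, 'n) tensor_gen \<Rightarrow> 'k) set" where
  "tensor_relspace K M N P Q =
     (\<lambda>H. submodule H K (tensor_free K M N)) hull tensor_relators K M N P Q"

text \<open>
  The bilinear extension to the free space of the operation which sends generators \<open>g\<close>, \<open>h\<close> to
  the symbol \<open>g\<^sub>M \<star> h\<^sub>N\<close>.
\<close>

definition tensor_pre_op ::
    "('k, 'e) ring_scheme \<Rightarrow> ('k, 'm) awb \<Rightarrow> ('k, 'n) awb \<Rightarrow>
     ('m, 'n) awb_action \<Rightarrow> ('n, 'm) awb_action \<Rightarrow> tensor_op \<Rightarrow>
     (('m, 'n) tensor_gen \<Rightarrow> 'k) \<Rightarrow> (('m, 'n) tensor_gen \<Rightarrow> 'k) \<Rightarrow> ('m, 'n) tensor_gen \<Rightarrow> 'k" where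
  "tensor_pre_op K M N P Q s p q =
     (let F = tensor_free K M N in
      lin_ext K F (\<lambda>g. lin_ext K F (\<lambda>h. basis_vec K (MN s (gen_fst Q g) (gen_snd P h))) q) p)"

text \<open>
  The tensor product is the quotient of the free space by \<open>tensor_relspace\<close>. As for the quotient
  ring \<^const>\<open>FactRing\<close>, operations on cosets are unions over all representatives.
\<close>

definition nonabelian_tensor ::
    "('k, 'e) ring_scheme \<Rightarrow> ('k, 'm) awb \<Rightarrow> ('k, 'n) awb \<Rightarrow>
     ('m, 'n) awb_action \<Rightarrow> ('n, 'm) awb_action \<Rightarrow> ('k, (('m, 'n) tensor_gen \<Rightarrow> 'k) set) awb" where
  "nonabelian_tensor K M N P Q =
     (let F = tensor_free K M N; R = tensor_relspace K M N P Q in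
      \<lparr>carrier = a_rcosets\<^bsub>F\<^esub> R,
       mult = (\<lambda>U V. \<Union>p\<in>U. \<Union>q\<in>V. R +>\<^bsub>F\<^esub> tensor_pre_op K M N P Q Odot p q),
       one = undefined,
       zero = R, add = set_add F,
       smult = (\<lambda>c U. \<Union>p\<in>U. R +>\<^bsub>F\<^esub> (c \<odot>\<^bsub>F\<^esub> p)),
       bracket = (\<lambda>U V. \<Union>p\<in>U. \<Union>q\<in>V. R +>\<^bsub>F\<^esub> tensor_pre_op K M N P Q Oast p q)\<rparr>)"

text \<open>
  The map \<open>\<psi>\<^sub>M\<close> induced by \<open>g \<mapsto> g\<^sub>M\<close>: the linear extension takes a single value on each coset.
\<close>

definition tensor_psi ::
    "('k, 'e) ring_scheme \<Rightarrow> ('k, 'm) awb \<Rightarrow> ('n, 'm) awb_action \<Rightarrow>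
     (('m, 'n) tensor_gen \<Rightarrow> 'k) set \<Rightarrow> 'm" where
  "tensor_psi K M Q U = the_elem (lin_ext K M (gen_fst Q) ` U)"

definition tensor_square ::
    "('k, 'e) ring_scheme \<Rightarrow> ('k, 'a) awb \<Rightarrow> ('k, (('a, 'a) tensor_gen \<Rightarrow> 'k) set) awb" where
  "tensor_square K A = nonabelian_tensor K A A (self_action A) (self_action A)"

definition psi ::
    "('k, 'e) ring_scheme \<Rightarrow> ('k, 'a) awb \<Rightarrow> (('a, 'a) tensor_gen \<Rightarrow> 'k) set \<Rightarrow> 'a" where
  "psi K A = tensor_psi K A (self_action A)"

end

theory Submission
  imports Defs
begin

text \<open>
  Everything rests on one observation: in a central extension \<open>\<chi> : C \<rightarrow> A\<close>, a product or bracket of two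
  elements of \<open>C\<close> depends only on their images in \<open>A\<close>, because it vanishes as soon as one of the arguments is
  in the kernel of \<open>\<chi>\<close>.

  Existence of a lift. Choose any set-theoretic section \<open>\<sigma>\<close> of \<open>\<chi>\<close> and send \<open>x \<odot> y\<close> to the product
  and \<open>x \<circledast> y\<close> to the bracket of \<open>\<sigma> x\<close> and \<open>\<sigma> y\<close>. Although \<open>\<sigma>\<close> need not preserve any operation, it may be treated
  as a homomorphism inside a product or bracket, so that the defining relations of \<open>A \<boxtimes> A\<close> turn into
  identities valid in every algebra with bracket (\<open>tensor_rel_lift\<close>, \<open>lift_relspace_zero\<close>). The
  resulting linear map on \<open>A \<boxtimes> A\<close> is \<open>lift_map C \<sigma>\<close>. The map \<open>\<psi>\<^sub>A\<close> is itself of this kind: it is the lift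
  to the trivial extension, given by the identity of \<open>A\<close>.

  The structure of \<open>A \<boxtimes> A\<close>. By bilinearity the operations satisfy \<open>U V = \<psi> U \<odot> \<psi> V\<close> and
  \<open>[U, V] = \<psi> U \<circledast> \<psi> V\<close> (\<open>op_T\<close>). Hence they are well defined, \<open>\<psi>\<close> is a homomorphism, its kernel is
  central, and associativity is the relation \<open>x y \<odot> z = x \<odot> y z\<close>. The relation that expands
  \<open>x y \<circledast> z\<close> gives \<open>[U V, W] = [U, W] V + U [V, W]\<close>, except that its two terms come from different
  copies of \<open>A\<close>. The relation \<open>u\<^sub>M \<star> v\<^sub>N = u\<^sub>N \<star> v\<^sub>M\<close> identifies the two copies for
  products and brackets \<open>u\<close>, \<open>v\<close>; as \<open>A\<close> is perfect, it is spanned by these (\<open>perfect_awb_span\<close>), so that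
  the two copies agree altogether (\<open>cls_nm_eq_mn\<close>). Perfectness also makes \<open>\<psi>\<close> onto.

  Uniqueness of the lift. Two homomorphisms over \<open>A\<close> into \<open>C\<close> agree on products and brackets by the
  observation above, and every generator of \<open>A \<boxtimes> A\<close> is one: \<open>x \<star> y\<close> is the product or
  bracket of any preimages of \<open>x\<close> and \<open>y\<close> under \<open>\<psi>\<close>.
\<close>

section \<open>Linear maps between modules\<close>

definition linear_maps ::
    "('k, 'e) ring_scheme \<Rightarrow> ('k, 'v, 'y) module_scheme \<Rightarrow> ('k, 'w, 'z) module_scheme \<Rightarrow>
     ('v \<Rightarrow> 'w) set" where
  "linear_maps K V W = {f. f \<in> carrier V \<rightarrow> carrier W \<and>
     (\<forall>x\<in>carrier V. \<forall>y\<in>carrier V. f (x \<oplus>\<^bsub>V\<^esub> y) = f x \<oplus>\<^bsub>W\<^esub> f y) \<and>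
     (\<forall>c\<in>carrier K. \<forall>x\<in>carrier V. f (c \<odot>\<^bsub>V\<^esub> x) = c \<odot>\<^bsub>W\<^esub> f x)}"

lemma linear_mapsI:
  assumes "\<And>x. x \<in> carrier V \<Longrightarrow> f x \<in> carrier W"
    and "\<And>x y. \<lbrakk>x \<in> carrier V; y \<in> carrier V\<rbrakk> \<Longrightarrow> f (x \<oplus>\<^bsub>V\<^esub> y) = f x \<oplus>\<^bsub>W\<^esub> f y"
    and "\<And>c x. \<lbrakk>c \<in> carrier K; x \<in> carrier V\<rbrakk> \<Longrightarrow> f (c \<odot>\<^bsub>V\<^esub> x) = c \<odot>\<^bsub>W\<^esub> f x"
  shows "f \<in> linear_maps K V W"
  using assms by (auto simp: linear_maps_def)

lemma linear_mapsD:
  assumes "f \<in> linear_maps K V W"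
  shows "x \<in> carrier V \<Longrightarrow> f x \<in> carrier W"
    and "\<lbrakk>x \<in> carrier V; y \<in> carrier V\<rbrakk> \<Longrightarrow> f (x \<oplus>\<^bsub>V\<^esub> y) = f x \<oplus>\<^bsub>W\<^esub> f y"
    and "\<lbrakk>c \<in> carrier K; x \<in> carrier V\<rbrakk> \<Longrightarrow> f (c \<odot>\<^bsub>V\<^esub> x) = c \<odot>\<^bsub>W\<^esub> f x"
  using assms by (auto simp: linear_maps_def)

lemma linear_maps_comp:
  assumes "f \<in> linear_maps K V W" and "g \<in> linear_maps K U V"
  shows "(\<lambda>x. f (g x)) \<in> linear_maps K U W"
  using assms by (auto intro!: linear_mapsI simp: linear_mapsD)

lemma linear_map_zero:
  assumes "module K V" "module K W" "f \<in> linear_maps K V W"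
  shows "f \<zero>\<^bsub>V\<^esub> = \<zero>\<^bsub>W\<^esub>"
proof -
  interpret V: module K V by fact
  interpret W: module K W by fact
  have "f \<zero>\<^bsub>V\<^esub> = f (\<zero>\<^bsub>K\<^esub> \<odot>\<^bsub>V\<^esub> \<zero>\<^bsub>V\<^esub>)" by simp
  also have "\<dots> = \<zero>\<^bsub>K\<^esub> \<odot>\<^bsub>W\<^esub> f \<zero>\<^bsub>V\<^esub>"
    using linear_mapsD(3)[OF assms(3) V.R.zero_closed V.zero_closed] .
  finally show ?thesis using linear_mapsD(1)[OF assms(3)] by simp
qed

lemma linear_map_uminus:
  assumes "module K V" "module K W" "f \<in> linear_maps K V W" "x \<in> carrier V"
  shows "f (\<ominus>\<^bsub>V\<^esub> x) = \<ominus>\<^bsub>W\<^esub> f x"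
proof -
  interpret V: module K V by fact
  interpret W: module K W by fact
  have "f (\<ominus>\<^bsub>V\<^esub> x) \<oplus>\<^bsub>W\<^esub> f x = f (\<ominus>\<^bsub>V\<^esub> x \<oplus>\<^bsub>V\<^esub> x)"
    using assms(4) by (simp add: linear_mapsD(2)[OF assms(3)])
  also have "\<dots> = \<zero>\<^bsub>W\<^esub>"
    using assms(4) linear_map_zero[OF assms(1-3)] by (simp add: V.l_neg)
  finally show ?thesis
    using assms(4) linear_mapsD(1)[OF assms(3)] by (simp add: W.minus_equality)
qed

lemma linear_map_minus:
  assumes "module K V" "module K W" "f \<in> linear_maps K V W" "x \<in> carrier V" "y \<in> carrier V"
  shows "f (x \<ominus>\<^bsub>V\<^esub> y) = f x \<ominus>\<^bsub>W\<^esub> f y"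
proof -
  interpret V: module K V by fact
  show ?thesis
    using assms(4,5) by (simp add: a_minus_def linear_mapsD(2)[OF assms(3)]
        linear_map_uminus[OF assms(1-3)])
qed

lemma equalizer_submodule:
  assumes "module K V" "module K W" "f \<in> linear_maps K V W" "g \<in> linear_maps K V W"
  shows "submodule {x \<in> carrier V. f x = g x} K V"
proof -
  interpret V: module K V by fact
  show ?thesis
    by (rule V.submoduleI)
      (auto simp: linear_mapsD[OF assms(3)] linear_mapsD[OF assms(4)]
        linear_map_zero[OF assms(1,2)] linear_map_uminus[OF assms(1,2)] assms(3,4))
qed

lemma zero_linear:
  assumes "module K W"
  shows "(\<lambda>_. \<zero>\<^bsub>W\<^esub>) \<in> linear_maps K V W"
proof -
  interpret W: module K W by fact
  show ?thesis by (auto intro!: linear_mapsI)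
qed

lemma image_submodule:
  assumes "module K V" "module K W" "f \<in> linear_maps K V W"
  shows "submodule (f ` carrier V) K W"
proof -
  interpret V: module K V by fact
  interpret W: module K W by fact
  note f = linear_mapsD[OF assms(3)]
  show ?thesis
  proof (rule W.submoduleI)
    show "f ` carrier V \<subseteq> carrier W" using f(1) by blast
    show "\<zero>\<^bsub>W\<^esub> \<in> f ` carrier V"
      using linear_map_zero[OF assms] by (intro image_eqI[of _ _ "\<zero>\<^bsub>V\<^esub>"]) simp_all
    fix a assume "a \<in> f ` carrier V"
    then obtain x where x: "x \<in> carrier V" "a = f x" by blast
    show "\<ominus>\<^bsub>W\<^esub> a \<in> f ` carrier V"
      using x linear_map_uminus[OF assms] by (intro image_eqI[of _ _ "\<ominus>\<^bsub>V\<^esub> x"]) simp_all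
    show "c \<odot>\<^bsub>W\<^esub> a \<in> f ` carrier V" if "c \<in> carrier K" for c
      using x f(3) that by (intro image_eqI[of _ _ "c \<odot>\<^bsub>V\<^esub> x"]) simp_all
    fix b assume "b \<in> f ` carrier V"
    then obtain y where y: "y \<in> carrier V" "b = f y" by blast
    show "a \<oplus>\<^bsub>W\<^esub> b \<in> f ` carrier V"
      using x y f(2) by (intro image_eqI[of _ _ "x \<oplus>\<^bsub>V\<^esub> y"]) simp_all
  qed
qed

lemma submodule_Inter:
  assumes "module K V" "\<forall>H\<in>\<H>. submodule H K V" "\<H> \<noteq> {}"
  shows "submodule (\<Inter>\<H>) K V"
proof -
  interpret V: module K V by fact
  have sub: "submodule H K V" if "H \<in> \<H>" for H using assms(2) that by blast
  show ?thesis
  proof (rule V.submoduleI)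
    show "\<Inter>\<H> \<subseteq> carrier V" using assms(3) V.submoduleE(1)[OF sub] by blast
    show "\<zero>\<^bsub>V\<^esub> \<in> \<Inter>\<H>"
      using subgroup.one_closed[OF submodule.axioms(1)[OF sub]] by auto
  qed (use V.submoduleE(3-5)[OF sub] in auto)
qed

lemma submodule_hull:
  assumes "module K V" "X \<subseteq> carrier V"
  shows "submodule ((\<lambda>H. submodule H K V) hull X) K V"
  unfolding hull_def
  by (rule submodule_Inter[OF assms(1)])
    (use assms(2) module.carrier_is_submodule[OF assms(1)] in auto)

section \<open>Free vector spaces\<close>

lemma free_space_module:
  assumes "cring K"
  shows "module K (free_space K S)"
proof -
  interpret K: cring K by fact
  let ?F = "free_space K S"
  have fin: "finite {s. f (p s) (q s) \<noteq> \<zero>\<^bsub>K\<^esub>}"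
    if "finite {s. p s \<noteq> \<zero>\<^bsub>K\<^esub>}" "finite {s. q s \<noteq> \<zero>\<^bsub>K\<^esub>}" "f \<zero>\<^bsub>K\<^esub> \<zero>\<^bsub>K\<^esub> = \<zero>\<^bsub>K\<^esub>"
    for f :: "_ \<Rightarrow> _ \<Rightarrow> _" and p q :: "_ \<Rightarrow> _"
    by (rule finite_subset[of _ "{s. p s \<noteq> \<zero>\<^bsub>K\<^esub>} \<union> {s. q s \<noteq> \<zero>\<^bsub>K\<^esub>}"]) (use that in auto)
  have in_K: "p s \<in> carrier K" if "p \<in> carrier ?F" for p s
    using that by (cases "s \<in> S") (auto simp: free_space_def)
  show ?thesis
  proof (rule moduleI)
    show "cring K" by fact
    show "abelian_group ?F"
    proof (rule abelian_groupI)
      fix p assume p: "p \<in> carrier ?F"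
      show "\<exists>q\<in>carrier ?F. q \<oplus>\<^bsub>?F\<^esub> p = \<zero>\<^bsub>?F\<^esub>"
        using p fin[of p p "\<lambda>x _. \<ominus>\<^bsub>K\<^esub> x"] in_K[OF p]
        by (intro bexI[of _ "\<lambda>s. \<ominus>\<^bsub>K\<^esub> p s"]) (auto simp: free_space_def K.l_neg)
    next
      fix p q assume pq: "p \<in> carrier ?F" "q \<in> carrier ?F"
      then show "p \<oplus>\<^bsub>?F\<^esub> q \<in> carrier ?F"
        using fin[of p q "\<lambda>x y. x \<oplus>\<^bsub>K\<^esub> y"] by (auto simp: free_space_def)
      show "p \<oplus>\<^bsub>?F\<^esub> q = q \<oplus>\<^bsub>?F\<^esub> p"
        using in_K[OF pq(1)] in_K[OF pq(2)] by (auto simp: free_space_def K.a_comm)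
    next
      fix p q r assume "p \<in> carrier ?F" "q \<in> carrier ?F" "r \<in> carrier ?F"
      note in_K[OF this(1)] in_K[OF this(2)] in_K[OF this(3)]
      then show "p \<oplus>\<^bsub>?F\<^esub> q \<oplus>\<^bsub>?F\<^esub> r = p \<oplus>\<^bsub>?F\<^esub> (q \<oplus>\<^bsub>?F\<^esub> r)"
        by (auto simp: free_space_def K.a_assoc)
    next
      fix p assume "p \<in> carrier ?F"
      from in_K[OF this] show "\<zero>\<^bsub>?F\<^esub> \<oplus>\<^bsub>?F\<^esub> p = p"
        by (auto simp: free_space_def)
    qed (simp add: free_space_def)
  next
    fix c p assume c: "c \<in> carrier K" and p: "p \<in> carrier ?F"
    then show "c \<odot>\<^bsub>?F\<^esub> p \<in> carrier ?F"
      using fin[of p p "\<lambda>x _. c \<otimes>\<^bsub>K\<^esub> x"] by (auto simp: free_space_def)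
    fix d assume d: "d \<in> carrier K"
    show "(c \<oplus>\<^bsub>K\<^esub> d) \<odot>\<^bsub>?F\<^esub> p = (c \<odot>\<^bsub>?F\<^esub> p) \<oplus>\<^bsub>?F\<^esub> (d \<odot>\<^bsub>?F\<^esub> p)"
      using in_K[OF p] c d by (simp add: free_space_def K.l_distr)
    show "(c \<otimes>\<^bsub>K\<^esub> d) \<odot>\<^bsub>?F\<^esub> p = c \<odot>\<^bsub>?F\<^esub> (d \<odot>\<^bsub>?F\<^esub> p)"
      using in_K[OF p] c d by (simp add: free_space_def K.m_assoc)
  next
    fix c p q assume c: "c \<in> carrier K" and p: "p \<in> carrier ?F" and q: "q \<in> carrier ?F"
    show "c \<odot>\<^bsub>?F\<^esub> (p \<oplus>\<^bsub>?F\<^esub> q) = (c \<odot>\<^bsub>?F\<^esub> p) \<oplus>\<^bsub>?F\<^esub> (c \<odot>\<^bsub>?F\<^esub> q)"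
      using in_K[OF p] in_K[OF q] c by (simp add: free_space_def K.r_distr)
  next
    fix p assume "p \<in> carrier ?F"
    from in_K[OF this] show "\<one>\<^bsub>K\<^esub> \<odot>\<^bsub>?F\<^esub> p = p" by (simp add: free_space_def)
  qed
qed

lemma basis_vec_in_free_space:
  assumes "cring K" "g \<in> S"
  shows "basis_vec K g \<in> carrier (free_space K S)"
proof -
  interpret K: cring K by fact
  show ?thesis
    using assms(2) finite_subset[of "{s. basis_vec K g s \<noteq> \<zero>\<^bsub>K\<^esub>}" "{g}"]
    by (auto simp: free_space_def basis_vec_def)
qed

text \<open>
  Every vector is a combination of basis vectors. The proof removes one point of the support at a time.
\<close>

lemma free_space_subset_submodule:
  assumes "cring K" and H: "submodule H K (free_space K S)"
    and basis: "\<And>g. g \<in> S \<Longrightarrow> basis_vec K g \<in> H"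
  shows "carrier (free_space K S) \<subseteq> H"
proof
  interpret K: cring K by fact
  let ?F = "free_space K S"
  interpret F: module K ?F by (rule free_space_module) fact
  note H_closed = F.submoduleE(4,5)[OF H]
  have zero: "\<zero>\<^bsub>?F\<^esub> \<in> H"
    using subgroup.one_closed[OF submodule.axioms(1)[OF H]] by simp
  fix p assume "p \<in> carrier ?F"
  then have "finite {s. p s \<noteq> \<zero>\<^bsub>K\<^esub>}" by (simp add: free_space_def)
  moreover have "p \<in> H"
    if "finite B" "p \<in> carrier ?F" "{s. p s \<noteq> \<zero>\<^bsub>K\<^esub>} \<subseteq> B" for B p
    using that
  proof (induction B arbitrary: p)
    case empty
    then have "p = \<zero>\<^bsub>?F\<^esub>" by (auto simp: free_space_def)
    then show ?case using zero by simp
  next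
    case (insert b B)
    show ?case
    proof (cases "b \<in> S")
      case False
      then have "p b = \<zero>\<^bsub>K\<^esub>" using insert.prems by (simp add: free_space_def)
      then show ?thesis using insert by blast
    next
      case True
      let ?q = "p(b := \<zero>\<^bsub>K\<^esub>)"
      have p_in: "p s \<in> carrier K" for s
        using insert.prems(1) by (cases "s \<in> S") (auto simp: free_space_def)
      have "finite {s. ?q s \<noteq> \<zero>\<^bsub>K\<^esub>}"
        by (rule finite_subset[of _ "{s. p s \<noteq> \<zero>\<^bsub>K\<^esub>}"])
          (use insert.prems(1) in \<open>auto simp: free_space_def\<close>)
      then have "?q \<in> carrier ?F"
        using insert.prems(1) True by (auto simp: free_space_def)
      moreover have "{s. ?q s \<noteq> \<zero>\<^bsub>K\<^esub>} \<subseteq> B" using insert.prems(2) by auto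
      ultimately have "?q \<in> H" by (rule insert.IH)
      moreover have "p = (p b \<odot>\<^bsub>?F\<^esub> basis_vec K b) \<oplus>\<^bsub>?F\<^esub> ?q"
        using p_in by (auto simp: free_space_def basis_vec_def)
      moreover have "p b \<odot>\<^bsub>?F\<^esub> basis_vec K b \<in> H"
        using H_closed(1) p_in basis True by blast
      ultimately show ?thesis using H_closed(2) by metis
    qed
  qed
  ultimately show "p \<in> H" using \<open>p \<in> carrier ?F\<close> by blast
qed

lemma free_space_map_eqI:
  assumes "module K W" "f \<in> linear_maps K (free_space K S) W" "g \<in> linear_maps K (free_space K S) W"
    and "\<And>s. s \<in> S \<Longrightarrow> f (basis_vec K s) = g (basis_vec K s)"
    and "p \<in> carrier (free_space K S)"
  shows "f p = g p"
proof -
  have K: "cring K" using assms(1) by (simp add: module_def)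
  have "carrier (free_space K S) \<subseteq> {p \<in> carrier (free_space K S). f p = g p}"
    by (rule free_space_subset_submodule[OF K
          equalizer_submodule[OF free_space_module[OF K] assms(1-3)]])
      (use assms(4) basis_vec_in_free_space[OF K] in auto)
  then show ?thesis using assms(5) by blast
qed

text \<open>
  The support of a sum can be smaller than the union of the supports. Summing over any larger finite
  set makes linearity of \<open>lin_ext\<close> a termwise matter.
\<close>

lemma lin_ext_finsum:
  assumes "module K V" "u \<in> S \<rightarrow> carrier V" "p \<in> carrier (free_space K S)"
    and "finite B" "{s. p s \<noteq> \<zero>\<^bsub>K\<^esub>} \<subseteq> B" "B \<subseteq> S"
  shows "lin_ext K V u p = (\<Oplus>\<^bsub>V\<^esub>s\<in>B. p s \<odot>\<^bsub>V\<^esub> u s)"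
proof -
  interpret V: module K V by fact
  show ?thesis
    unfolding lin_ext_def
    by (rule V.add.finprod_mono_neutral_cong_left)
      (use assms in \<open>auto simp: free_space_def Pi_def subset_iff\<close>)
qed

lemma lin_ext_linear:
  assumes "module K V" "u \<in> S \<rightarrow> carrier V"
  shows "lin_ext K V u \<in> linear_maps K (free_space K S) V"
proof -
  interpret V: module K V by fact
  let ?F = "free_space K S"
  have closed: "p s \<odot>\<^bsub>V\<^esub> u s \<in> carrier V" if "p \<in> carrier ?F" "s \<in> S" for p s
    using that assms(2) by (auto simp: free_space_def)
  let ?supp = "\<lambda>p. {s. p s \<noteq> \<zero>\<^bsub>K\<^esub>}"
  have supp: "finite (?supp p)" "?supp p \<subseteq> S" if "p \<in> carrier ?F" for p
    using that by (auto simp: free_space_def)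
  interpret F: module K ?F by (rule free_space_module) (rule V.R.is_cring)
  note ext = lin_ext_finsum[OF assms]
  show ?thesis
  proof (rule linear_mapsI)
    fix p assume p: "p \<in> carrier ?F"
    show "lin_ext K V u p \<in> carrier V"
      unfolding lin_ext_def using closed[OF p] supp[OF p] by (auto intro!: V.finsum_closed)
    fix c assume c: "c \<in> carrier K"
    have "?supp (c \<odot>\<^bsub>?F\<^esub> p) \<subseteq> ?supp p" using c by (auto simp: free_space_def)
    then have "lin_ext K V u (c \<odot>\<^bsub>?F\<^esub> p) = (\<Oplus>\<^bsub>V\<^esub>s\<in>?supp p. (c \<odot>\<^bsub>?F\<^esub> p) s \<odot>\<^bsub>V\<^esub> u s)"
      by (rule ext[OF F.smult_closed[OF c p] supp(1)[OF p] _ supp(2)[OF p]])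
    also have "\<dots> = (\<Oplus>\<^bsub>V\<^esub>s\<in>?supp p. c \<odot>\<^bsub>V\<^esub> (p s \<odot>\<^bsub>V\<^esub> u s))"
    proof (rule V.finsum_cong'[OF refl])
      fix s assume "s \<in> ?supp p"
      then have "s \<in> S" using supp(2)[OF p] by blast
      then show "(c \<odot>\<^bsub>?F\<^esub> p) s \<odot>\<^bsub>V\<^esub> u s = c \<odot>\<^bsub>V\<^esub> (p s \<odot>\<^bsub>V\<^esub> u s)"
        using p c funcset_mem[OF assms(2)] by (simp add: free_space_def V.smult_assoc1)
    qed (use c closed[OF p] supp(2)[OF p] in auto)
    also have "\<dots> = c \<odot>\<^bsub>V\<^esub> lin_ext K V u p"
      unfolding lin_ext_def using closed[OF p] supp[OF p] c
      by (subst V.finsum_smult_ldistr) auto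
    finally show "lin_ext K V u (c \<odot>\<^bsub>?F\<^esub> p) = c \<odot>\<^bsub>V\<^esub> lin_ext K V u p" .
  next
    fix p q assume p: "p \<in> carrier ?F" and q: "q \<in> carrier ?F"
    let ?B = "?supp p \<union> ?supp q"
    have B: "finite ?B" "?B \<subseteq> S" using supp p q by auto
    have "?supp (p \<oplus>\<^bsub>?F\<^esub> q) \<subseteq> ?B" by (auto simp: free_space_def)
    then have "lin_ext K V u (p \<oplus>\<^bsub>?F\<^esub> q) = (\<Oplus>\<^bsub>V\<^esub>s\<in>?B. (p \<oplus>\<^bsub>?F\<^esub> q) s \<odot>\<^bsub>V\<^esub> u s)"
      by (rule ext[OF F.a_closed[OF p q] B(1) _ B(2)])
    also have "\<dots> = (\<Oplus>\<^bsub>V\<^esub>s\<in>?B. p s \<odot>\<^bsub>V\<^esub> u s \<oplus>\<^bsub>V\<^esub> q s \<odot>\<^bsub>V\<^esub> u s)"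
    proof (rule V.finsum_cong'[OF refl])
      fix s assume "s \<in> ?B"
      then have "s \<in> S" using B(2) by blast
      then show "(p \<oplus>\<^bsub>?F\<^esub> q) s \<odot>\<^bsub>V\<^esub> u s = p s \<odot>\<^bsub>V\<^esub> u s \<oplus>\<^bsub>V\<^esub> q s \<odot>\<^bsub>V\<^esub> u s"
        using p q funcset_mem[OF assms(2)] by (simp add: free_space_def V.smult_l_distr)
    qed (use closed[OF p] closed[OF q] B(2) in auto)
    also have "\<dots> = (\<Oplus>\<^bsub>V\<^esub>s\<in>?B. p s \<odot>\<^bsub>V\<^esub> u s) \<oplus>\<^bsub>V\<^esub> (\<Oplus>\<^bsub>V\<^esub>s\<in>?B. q s \<odot>\<^bsub>V\<^esub> u s)"
      by (rule V.finsum_addf) (use closed[OF p] closed[OF q] B(2) in auto)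
    also have "\<dots> = lin_ext K V u p \<oplus>\<^bsub>V\<^esub> lin_ext K V u q"
      using ext[OF p B(1) _ B(2)] ext[OF q B(1) _ B(2)] by simp
    finally show "lin_ext K V u (p \<oplus>\<^bsub>?F\<^esub> q) = lin_ext K V u p \<oplus>\<^bsub>V\<^esub> lin_ext K V u q" .
  qed
qed

lemma lin_ext_basis_vec:
  assumes "module K V" "u g \<in> carrier V"
  shows "lin_ext K V u (basis_vec K g) = u g"
proof -
  interpret V: module K V by fact
  have "lin_ext K V u (basis_vec K g) = (\<Oplus>\<^bsub>V\<^esub>s\<in>{g}. basis_vec K g s \<odot>\<^bsub>V\<^esub> u s)"
    by (rule lin_ext_finsum[OF assms(1), of _ "{g}"])
      (use assms(2) basis_vec_in_free_space[OF V.R.is_cring, of g "{g}"] in \<open>auto simp: basis_vec_def\<close>)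
  then show ?thesis using assms(2) by (simp add: basis_vec_def)
qed

section \<open>Quotients of modules\<close>

text \<open>
  The parameter \<open>T\<close> is only required to carry the coset operations in its module fields, so that the locale
  applies to records with additional operations.
\<close>

locale quotient_module = F: module K F + R: submodule R K F
  for K :: "('k, 'e) ring_scheme" and F :: "('k, 'f, 'y) module_scheme" and R +
  fixes T :: "('k, 'f set, 'z) module_scheme"
  assumes carrier_T: "carrier T = a_rcosets\<^bsub>F\<^esub> R"
    and zero_T: "\<zero>\<^bsub>T\<^esub> = R"
    and add_T: "(\<oplus>\<^bsub>T\<^esub>) = set_add F"
    and smult_T: "\<And>c U. c \<odot>\<^bsub>T\<^esub> U = (\<Union>p\<in>U. R +>\<^bsub>F\<^esub> (c \<odot>\<^bsub>F\<^esub> p))"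
begin

abbreviation cls where "cls p \<equiv> R +>\<^bsub>F\<^esub> p"

sublocale AR: abelian_subgroup R F
  by (rule abelian_subgroupI3)
    (auto intro!: additive_subgroupI R.subgroup_axioms F.abelian_group_axioms)

lemma T_cases:
  assumes "U \<in> carrier T"
  obtains p where "p \<in> carrier F" "U = cls p"
  using assms by (auto simp: carrier_T A_RCOSETS_def')

lemma cls_closed: "p \<in> carrier F \<Longrightarrow> cls p \<in> carrier T"
  by (auto simp: carrier_T A_RCOSETS_def')

lemma mem_cls_iff:
  assumes "p \<in> carrier F"
  shows "q \<in> cls p \<longleftrightarrow> q \<in> carrier F \<and> q \<ominus>\<^bsub>F\<^esub> p \<in> R"
  using AR.a_rcos_module[OF assms] AR.a_elemrcos_carrier[OF assms]
  by (auto simp: a_minus_def)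

lemma cls_eq_iff:
  assumes "p \<in> carrier F" "q \<in> carrier F"
  shows "cls p = cls q \<longleftrightarrow> p \<ominus>\<^bsub>F\<^esub> q \<in> R"
  by (metis AR.a_rcos_self AR.a_repr_independence' assms mem_cls_iff)

lemma cls_eqI: "\<lbrakk>p \<in> carrier F; q \<in> cls p\<rbrakk> \<Longrightarrow> cls q = cls p"
  using AR.a_repr_independence' by blast

lemma Union_cls:
  assumes "p \<in> carrier F" "\<And>q. q \<in> cls p \<Longrightarrow> f q = f p"
  shows "(\<Union>q\<in>cls p. f q) = f p"
  using assms AR.a_rcos_self[OF assms(1)] by blast

lemma smult_cls:
  assumes c: "c \<in> carrier K" and p: "p \<in> carrier F"
  shows "c \<odot>\<^bsub>T\<^esub> cls p = cls (c \<odot>\<^bsub>F\<^esub> p)"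
  unfolding smult_T
proof (rule Union_cls[OF p])
  fix q assume "q \<in> cls p"
  then have q: "q \<in> carrier F" "q \<ominus>\<^bsub>F\<^esub> p \<in> R" using p by (auto simp: mem_cls_iff)
  have "c \<odot>\<^bsub>F\<^esub> q \<ominus>\<^bsub>F\<^esub> c \<odot>\<^bsub>F\<^esub> p = c \<odot>\<^bsub>F\<^esub> (q \<ominus>\<^bsub>F\<^esub> p)"
    using c p q(1) by (simp add: a_minus_def F.smult_r_distr F.smult_r_minus)
  also have "\<dots> \<in> R" using c q(2) by (rule R.smult_closed)
  finally show "cls (c \<odot>\<^bsub>F\<^esub> q) = cls (c \<odot>\<^bsub>F\<^esub> p)" using c p q(1) by (simp add: cls_eq_iff)
qed

lemma add_cls:
  "\<lbrakk>p \<in> carrier F; q \<in> carrier F\<rbrakk> \<Longrightarrow> cls p \<oplus>\<^bsub>T\<^esub> cls q = cls (p \<oplus>\<^bsub>F\<^esub> q)"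
  by (simp add: add_T AR.a_rcos_sum)

lemma zero_cls: "\<zero>\<^bsub>T\<^esub> = cls \<zero>\<^bsub>F\<^esub>"
  by (simp add: zero_T AR.a_subset)

lemma module_T: "module K T"
proof (rule moduleI)
  show "cring K" by (rule F.R.is_cring)
  show "abelian_group T"
  proof (rule abelian_groupI)
    fix U assume "U \<in> carrier T"
    then obtain p where p: "p \<in> carrier F" "U = cls p" by (rule T_cases)
    show "\<exists>V\<in>carrier T. V \<oplus>\<^bsub>T\<^esub> U = \<zero>\<^bsub>T\<^esub>"
      by (rule bexI[of _ "cls (\<ominus>\<^bsub>F\<^esub> p)"])
        (use p in \<open>simp_all add: add_cls zero_cls cls_closed F.l_neg\<close>)
  qed (auto elim!: T_cases simp: add_cls zero_cls cls_closed F.a_ac)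
qed (auto elim!: T_cases simp: add_cls smult_cls cls_closed
       F.smult_l_distr F.smult_r_distr F.smult_assoc1)

lemma cls_linear: "cls \<in> linear_maps K F T"
  by (rule linear_mapsI) (simp_all add: cls_closed add_cls smult_cls)

text \<open>
  A linear map that vanishes on \<open>R\<close> is constant on each coset, so \<open>the_elem\<close> of the image of a coset is
  that constant value.
\<close>

context
  fixes W :: "('k, 'w, 'x) module_scheme" and f
  assumes W: "module K W" and f: "f \<in> linear_maps K F W"
    and f_R: "\<And>p. p \<in> R \<Longrightarrow> f p = \<zero>\<^bsub>W\<^esub>"
begin

lemma factor_cls:
  assumes p: "p \<in> carrier F"
  shows "the_elem (f ` cls p) = f p"
proof -
  interpret W: module K W by (rule W)
  have "f q = f p" if "q \<in> cls p" for q
  proof -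
    have q: "q \<in> carrier F" "q \<ominus>\<^bsub>F\<^esub> p \<in> R" using that p by (auto simp: mem_cls_iff)
    have "q = (q \<ominus>\<^bsub>F\<^esub> p) \<oplus>\<^bsub>F\<^esub> p" using p q(1) by (simp add: a_minus_def F.a_assoc F.l_neg)
    then have "f q = f (q \<ominus>\<^bsub>F\<^esub> p) \<oplus>\<^bsub>W\<^esub> f p" using p q(1) linear_mapsD(2)[OF f]
      by (metis F.minus_closed)
    then show ?thesis using f_R[OF q(2)] linear_mapsD(1)[OF f p] by simp
  qed
  then have "f ` cls p = {f p}" using AR.a_rcos_self[OF p] by blast
  then show ?thesis by simp
qed

lemma factor_linear: "(\<lambda>U. the_elem (f ` U)) \<in> linear_maps K T W"
  by (rule linear_mapsI)
    (auto elim!: T_cases simp: add_cls smult_cls factor_cls linear_mapsD[OF f])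

end

end

section \<open>Algebras with bracket\<close>

text \<open>
  Product and bracket are indexed by \<^typ>\<open>tensor_op\<close>, since most arguments below treat both alike.
\<close>

definition awb_op :: "('k, 'a) awb \<Rightarrow> tensor_op \<Rightarrow> 'a \<Rightarrow> 'a \<Rightarrow> 'a" where
  "awb_op A s = (case s of Odot \<Rightarrow> (\<otimes>\<^bsub>A\<^esub>) | Oast \<Rightarrow> bracket A)"

lemma awb_op_simps [simp]:
  "awb_op A Odot x y = x \<otimes>\<^bsub>A\<^esub> y"
  "awb_op A Oast x y = bracket A x y"
  by (simp_all add: awb_op_def)

lemma all_tensor_op: "(\<forall>s. P s) \<longleftrightarrow> P Odot \<and> P Oast"
  by (metis tensor_op.exhaust)

lemma awb_module: "awb K A \<Longrightarrow> module K A"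
  by (simp add: awb_def)

lemma awb_op_bilinear: "awb K A \<Longrightarrow> bilinear_op K A (awb_op A s)"
  by (cases s) (simp_all add: awb_op_def awb.mult_bilinear awb.bracket_bilinear)

lemma awb_op_closed:
  "\<lbrakk>awb K A; x \<in> carrier A; y \<in> carrier A\<rbrakk> \<Longrightarrow> awb_op A s x y \<in> carrier A"
  using awb_op_bilinear[of K A s] by (simp add: bilinear_op_def)

lemma awb_op_linear_left:
  "\<lbrakk>awb K A; y \<in> carrier A\<rbrakk> \<Longrightarrow> (\<lambda>x. awb_op A s x y) \<in> linear_maps K A A"
  using awb_op_bilinear[of K A s] by (intro linear_mapsI) (auto simp: bilinear_op_def)

lemma awb_op_linear_right:
  "\<lbrakk>awb K A; x \<in> carrier A\<rbrakk> \<Longrightarrow> awb_op A s x \<in> linear_maps K A A"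
  using awb_op_bilinear[of K A s] by (intro linear_mapsI) (auto simp: bilinear_op_def)

lemma bilinear_opI:
  assumes "\<And>y. y \<in> carrier A \<Longrightarrow> (\<lambda>x. f x y) \<in> linear_maps K A A"
    and "\<And>x. x \<in> carrier A \<Longrightarrow> f x \<in> linear_maps K A A"
  shows "bilinear_op K A f"
  unfolding bilinear_op_def
  using linear_mapsD[OF assms(1)] linear_mapsD[OF assms(2)] by auto

lemma awb_hom_iff:
  "f \<in> awb_hom K A B \<longleftrightarrow> f \<in> linear_maps K A B \<and>
     (\<forall>s. \<forall>x\<in>carrier A. \<forall>y\<in>carrier A. f (awb_op A s x y) = awb_op B s (f x) (f y))"
  unfolding all_tensor_op by (auto simp: awb_hom_def linear_maps_def)

lemma restrict_awb_hom:
  assumes B: "awb K B" and f: "f \<in> awb_hom K B C"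
  shows "restrict f (carrier B) \<in> awb_hom K B C"
proof -
  interpret B: module K B using B by (rule awb_module)
  show ?thesis
    using f by (auto simp: awb_hom_iff awb_op_closed[OF B] linear_maps_def)
qed

lemma mem_awb_center_iff:
  "a \<in> awb_center A \<longleftrightarrow> a \<in> carrier A \<and>
     (\<forall>b\<in>carrier A. \<forall>s. awb_op A s a b = \<zero>\<^bsub>A\<^esub> \<and> awb_op A s b a = \<zero>\<^bsub>A\<^esub>)"
  unfolding all_tensor_op by (auto simp: awb_center_def)

text \<open>
  A subspace that contains all products and brackets absorbs multiplication by arbitrary elements, hence is an
  ideal. The ideal generated by products and brackets is therefore just their linear span.
\<close>

lemma perfect_awb_span:
  assumes A: "awb K A" and perfect: "perfect_awb K A" and H: "submodule H K A"
    and ops: "\<And>s x y. \<lbrakk>x \<in> carrier A; y \<in> carrier A\<rbrakk> \<Longrightarrow> awb_op A s x y \<in> H"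
  shows "carrier A \<subseteq> H"
proof -
  note ops' = ops[of _ _ Odot, simplified] ops[of _ _ Oast, simplified]
  have "H \<subseteq> carrier A" using module.submoduleE(1)[OF awb_module[OF A] H] .
  then have "awb_ideal K A H" using H ops' by (auto simp: awb_ideal_def)
  then have "commutator_ideal K A \<subseteq> H"
    unfolding commutator_ideal_def using ops' by (intro hull_minimal) auto
  then show ?thesis using perfect by (simp add: perfect_awb_def)
qed

section \<open>Lifting the tensor relations to central extensions\<close>

text \<open>
  With \<open>C = A\<close> and \<open>\<sigma>\<close> the identity this is the value of \<open>\<psi>\<^sub>A\<close> on generators, and also both components of
  the basic pair of a generator for the self-action (the next two equations on \<open>gen_fst\<close> and \<open>gen_snd\<close>).
\<close>

fun gen_val :: "('k, 'c) awb \<Rightarrow> ('a \<Rightarrow> 'c) \<Rightarrow> ('a, 'a) tensor_gen \<Rightarrow> 'c" where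
  "gen_val C \<sigma> (MN s x y) = awb_op C s (\<sigma> x) (\<sigma> y)"
| "gen_val C \<sigma> (NM s x y) = awb_op C s (\<sigma> x) (\<sigma> y)"

lemma self_action_simps [simp]:
  "ldot (self_action A) x y = x \<otimes>\<^bsub>A\<^esub> y"
  "rdot (self_action A) x y = x \<otimes>\<^bsub>A\<^esub> y"
  "lstar (self_action A) x y = bracket A x y"
  "rstar (self_action A) x y = bracket A x y"
  by (simp_all add: self_action_def)

lemma gen_fst_self_action: "gen_fst (self_action A) = gen_val A (\<lambda>x. x)"
proof
  fix g show "gen_fst (self_action A) g = gen_val A (\<lambda>x. x) g"
  proof (cases g)
    case (MN s x y) then show ?thesis by (cases s) simp_all
  next
    case (NM s x y) then show ?thesis by (cases s) simp_all
  qed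
qed

lemma gen_snd_self_action: "gen_snd (self_action A) = gen_val A (\<lambda>x. x)"
proof
  fix g show "gen_snd (self_action A) g = gen_val A (\<lambda>x. x) g"
  proof (cases g)
    case (MN s x y) then show ?thesis by (cases s) simp_all
  next
    case (NM s x y) then show ?thesis by (cases s) simp_all
  qed
qed

lemma tensor_rel_closed:
  assumes A: "awb K A" and F: "module K F"
    and xy: "\<And>s x y. \<lbrakk>x \<in> carrier A; y \<in> carrier A\<rbrakk> \<Longrightarrow> xy s x y \<in> carrier F"
    and yx: "\<And>s x y. \<lbrakk>x \<in> carrier A; y \<in> carrier A\<rbrakk> \<Longrightarrow> yx s x y \<in> carrier F"
    and rel: "tensor_rel K F A A (self_action A) xy yx l r"
  shows "l \<in> carrier F \<and> r \<in> carrier F"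
proof -
  interpret F: module K F by fact
  interpret A: module K A using A by (rule awb_module)
  note op = awb_op_closed[OF A, of _ _ Odot, simplified] awb_op_closed[OF A, of _ _ Oast, simplified]
  show ?thesis
    using rel by cases (simp_all add: xy yx op)
qed

text \<open>
  The section \<open>\<sigma>\<close> is merely a map of sets: a section that is a homomorphism need not exist.
\<close>

locale central_lift =
  fixes K :: "('k, 'e) ring_scheme" and A :: "('k, 'a) awb" and C :: "('k, 'c) awb"
    and \<chi> :: "'c \<Rightarrow> 'a" and \<sigma> :: "'a \<Rightarrow> 'c"
  assumes ext: "central_extension K C A \<chi>"
    and \<sigma>_closed: "a \<in> carrier A \<Longrightarrow> \<sigma> a \<in> carrier C"
    and \<chi>_\<sigma>: "a \<in> carrier A \<Longrightarrow> \<chi> (\<sigma> a) = a"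
begin

lemma awb_C: "awb K C" and awb_A: "awb K A" and \<chi>_hom: "\<chi> \<in> awb_hom K C A"
  and kernel_central: "a_kernel C A \<chi> \<subseteq> awb_center C"
  using ext by (auto simp: central_extension_def)

sublocale C: module K C by (rule awb_module[OF awb_C])
sublocale A: module K A by (rule awb_module[OF awb_A])

lemma \<chi>_linear: "\<chi> \<in> linear_maps K C A"
  using \<chi>_hom by (simp add: awb_hom_iff)

lemma \<chi>_op: "\<lbrakk>c \<in> carrier C; d \<in> carrier C\<rbrakk> \<Longrightarrow> \<chi> (awb_op C s c d) = awb_op A s (\<chi> c) (\<chi> d)"
  using \<chi>_hom by (simp add: awb_hom_iff)

text \<open>
  The difference \<open>c - c'\<close> is in the kernel of \<open>\<chi>\<close>, hence central, hence annihilates \<open>d\<close> on both sides.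
\<close>

lemma op_lift_indep_one:
  assumes c: "c \<in> carrier C" "c' \<in> carrier C" "\<chi> c = \<chi> c'" and d: "d \<in> carrier C"
  shows "awb_op C s c d = awb_op C s c' d" "awb_op C s d c = awb_op C s d c'"
proof -
  have "\<chi> (c \<ominus>\<^bsub>C\<^esub> c') = \<zero>\<^bsub>A\<^esub>"
    using linear_map_minus[OF C.module_axioms A.module_axioms \<chi>_linear c(1,2)] c
      linear_mapsD(1)[OF \<chi>_linear] by (simp add: A.r_neg a_minus_def)
  then have "c \<ominus>\<^bsub>C\<^esub> c' \<in> awb_center C"
    using kernel_central c by (auto simp: a_kernel_def kernel_def)
  then have 0: "awb_op C s (c \<ominus>\<^bsub>C\<^esub> c') d = \<zero>\<^bsub>C\<^esub>" "awb_op C s d (c \<ominus>\<^bsub>C\<^esub> c') = \<zero>\<^bsub>C\<^esub>"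
    using d by (auto simp: mem_awb_center_iff)
  have eq: "c = (c \<ominus>\<^bsub>C\<^esub> c') \<oplus>\<^bsub>C\<^esub> c'"
    using c by (simp add: a_minus_def C.a_assoc C.l_neg)
  have m: "c \<ominus>\<^bsub>C\<^esub> c' \<in> carrier C" using c by simp
  note closed = awb_op_closed[OF awb_C]
  show "awb_op C s c d = awb_op C s c' d"
    using linear_mapsD(2)[OF awb_op_linear_left[OF awb_C d, of s] m c(2)] 0 eq closed[OF c(2) d]
    by simp
  show "awb_op C s d c = awb_op C s d c'"
    using linear_mapsD(2)[OF awb_op_linear_right[OF awb_C d, of s] m c(2)] 0 eq closed[OF d c(2)]
    by simp
qed

lemma op_lift_indep:
  assumes "c \<in> carrier C" "c' \<in> carrier C" "\<chi> c = \<chi> c'"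
    and "d \<in> carrier C" "d' \<in> carrier C" "\<chi> d = \<chi> d'"
  shows "awb_op C s c d = awb_op C s c' d'"
  using op_lift_indep_one(1)[OF assms(1-4)] op_lift_indep_one(2)[OF assms(4-6,2)] by simp

text \<open>
  Both \<open>\<sigma> (x + y)\<close> and \<open>\<sigma> x + \<sigma> y\<close> lift \<open>x + y\<close>, so an operation cannot tell them apart; likewise for
  multiples, products and brackets. Inside an operation, \<open>\<sigma>\<close> thus behaves like a homomorphism.
\<close>

lemma \<sigma>_add:
  assumes "x \<in> carrier A" "y \<in> carrier A" "d \<in> carrier C"
  shows "awb_op C s (\<sigma> (x \<oplus>\<^bsub>A\<^esub> y)) d = awb_op C s (\<sigma> x) d \<oplus>\<^bsub>C\<^esub> awb_op C s (\<sigma> y) d"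
    and "awb_op C s d (\<sigma> (x \<oplus>\<^bsub>A\<^esub> y)) = awb_op C s d (\<sigma> x) \<oplus>\<^bsub>C\<^esub> awb_op C s d (\<sigma> y)"
  using assms linear_mapsD(2)[OF awb_op_linear_left[OF awb_C assms(3)], of "\<sigma> x" "\<sigma> y"]
    linear_mapsD(2)[OF awb_op_linear_right[OF awb_C assms(3)], of "\<sigma> x" "\<sigma> y"]
    op_lift_indep_one[of "\<sigma> (x \<oplus>\<^bsub>A\<^esub> y)" "\<sigma> x \<oplus>\<^bsub>C\<^esub> \<sigma> y" d s]
  by (simp_all add: \<sigma>_closed \<chi>_\<sigma> linear_mapsD(2)[OF \<chi>_linear])

lemma \<sigma>_smult:
  assumes "c \<in> carrier K" "x \<in> carrier A" "d \<in> carrier C"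
  shows "awb_op C s (\<sigma> (c \<odot>\<^bsub>A\<^esub> x)) d = c \<odot>\<^bsub>C\<^esub> awb_op C s (\<sigma> x) d"
    and "awb_op C s d (\<sigma> (c \<odot>\<^bsub>A\<^esub> x)) = c \<odot>\<^bsub>C\<^esub> awb_op C s d (\<sigma> x)"
  using assms linear_mapsD(3)[OF awb_op_linear_left[OF awb_C assms(3)], of c "\<sigma> x"]
    linear_mapsD(3)[OF awb_op_linear_right[OF awb_C assms(3)], of c "\<sigma> x"]
    op_lift_indep_one[of "\<sigma> (c \<odot>\<^bsub>A\<^esub> x)" "c \<odot>\<^bsub>C\<^esub> \<sigma> x" d s]
  by (simp_all add: \<sigma>_closed \<chi>_\<sigma> linear_mapsD(3)[OF \<chi>_linear])

lemma \<sigma>_op: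
  assumes "x \<in> carrier A" "y \<in> carrier A" "d \<in> carrier C"
  shows "awb_op C s (\<sigma> (awb_op A t x y)) d = awb_op C s (awb_op C t (\<sigma> x) (\<sigma> y)) d"
    and "awb_op C s d (\<sigma> (awb_op A t x y)) = awb_op C s d (awb_op C t (\<sigma> x) (\<sigma> y))"
  using assms
  by (auto intro!: op_lift_indep_one
      simp: \<sigma>_closed \<chi>_\<sigma> \<chi>_op awb_op_closed[OF awb_A] awb_op_closed[OF awb_C])

text \<open>
  After moving \<open>\<sigma>\<close> inside the operations, each relation becomes associativity, the bracket law or
  bilinearity in \<open>C\<close>. As \<open>f\<close> takes the same values on \<open>xy\<close> and \<open>yx\<close>, the lemma covers the relations of
  both copies of \<open>A\<close>.
\<close>

lemma tensor_rel_lift: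
  assumes F: "module K F" and f: "f \<in> linear_maps K F C"
    and closed: "\<And>s x y. \<lbrakk>x \<in> carrier A; y \<in> carrier A\<rbrakk> \<Longrightarrow> xy s x y \<in> carrier F"
      "\<And>s x y. \<lbrakk>x \<in> carrier A; y \<in> carrier A\<rbrakk> \<Longrightarrow> yx s x y \<in> carrier F"
    and f_gen: "\<And>s x y. \<lbrakk>x \<in> carrier A; y \<in> carrier A\<rbrakk> \<Longrightarrow> f (xy s x y) = awb_op C s (\<sigma> x) (\<sigma> y)"
      "\<And>s x y. \<lbrakk>x \<in> carrier A; y \<in> carrier A\<rbrakk> \<Longrightarrow> f (yx s x y) = awb_op C s (\<sigma> x) (\<sigma> y)"
    and rel: "tensor_rel K F A A (self_action A) xy yx l r"
  shows "f l = f r"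
proof -
  interpret F: module K F by fact
  note A_op = awb_op_closed[OF awb_A, of _ _ Odot, simplified]
    awb_op_closed[OF awb_A, of _ _ Oast, simplified]
  note C_op = awb_op_closed[OF awb_C, of _ _ Odot, simplified]
    awb_op_closed[OF awb_C, of _ _ Oast, simplified]
  note ops = \<sigma>_op[of _ _ _ Odot Odot, simplified] \<sigma>_op[of _ _ _ Odot Oast, simplified]
    \<sigma>_op[of _ _ _ Oast Odot, simplified] \<sigma>_op[of _ _ _ Oast Oast, simplified]
  note [simp] = closed f_gen A_op C_op \<sigma>_closed linear_mapsD(2,3)[OF f] ops
    awb.mult_assoc[OF awb_C] awb.bracket_mult[OF awb_C]
  show ?thesis
    using rel
  proof cases
    case (mult_oast x1 x2 y)
    then show ?thesis by (simp add: C.a_comm)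
  next
    case (ldot_oast x1 x2 y)
    then show ?thesis by (simp add: C.a_comm)
  qed (simp_all add: \<sigma>_add \<sigma>_smult)
qed

end

text \<open>The trivial extension, which makes every statement about lifts applicable to \<open>\<psi>\<^sub>A\<close>.\<close>

lemma identity_central_lift:
  assumes A: "awb K A"
  shows "central_lift K A A (\<lambda>x. x) (\<lambda>x. x)"
proof
  interpret A: module K A using A by (rule awb_module)
  have "\<zero>\<^bsub>A\<^esub> \<in> awb_center A"
    using linear_map_zero[OF A.module_axioms A.module_axioms awb_op_linear_left[OF A]]
      linear_map_zero[OF A.module_axioms A.module_axioms awb_op_linear_right[OF A]]
    by (simp add: mem_awb_center_iff)
  then show "central_extension K A A (\<lambda>x. x)"
    using A by (auto simp: central_extension_def awb_hom_def a_kernel_def kernel_def)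
qed simp_all

section \<open>The tensor square as a quotient space\<close>

locale awb_square =
  fixes K :: "('k, 'e) ring_scheme" and A :: "('k, 'a) awb"
  assumes awb_A: "awb K A"
begin

abbreviation "F \<equiv> free_space K (tensor_gens A A)"
abbreviation "R \<equiv> tensor_relspace K A A (self_action A) (self_action A)"
abbreviation "T \<equiv> tensor_square K A"
abbreviation "mn s x y \<equiv> basis_vec K (MN s x y)"
abbreviation "nm s x y \<equiv> basis_vec K (NM s x y)"
abbreviation "eval_A \<equiv> lin_ext K A (gen_val A (\<lambda>x. x))"

sublocale A: module K A by (rule awb_module[OF awb_A])
sublocale F: module K F by (rule free_space_module[OF A.R.is_cring])

lemma gens: "\<lbrakk>x \<in> carrier A; y \<in> carrier A\<rbrakk> \<Longrightarrow> MN s x y \<in> tensor_gens A A"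
  "\<lbrakk>x \<in> carrier A; y \<in> carrier A\<rbrakk> \<Longrightarrow> NM s x y \<in> tensor_gens A A"
  by (auto simp: tensor_gens_def)

lemma gens_cases:
  assumes "g \<in> tensor_gens A A"
  obtains s x y where "x \<in> carrier A" "y \<in> carrier A" "g = MN s x y"
  | s x y where "x \<in> carrier A" "y \<in> carrier A" "g = NM s x y"
  using assms by (auto simp: tensor_gens_def)

lemma basis_closed: "g \<in> tensor_gens A A \<Longrightarrow> basis_vec K g \<in> carrier F"
  by (rule basis_vec_in_free_space[OF A.R.is_cring])

lemma mn_closed: "\<lbrakk>x \<in> carrier A; y \<in> carrier A\<rbrakk> \<Longrightarrow> mn s x y \<in> carrier F"
  and nm_closed: "\<lbrakk>x \<in> carrier A; y \<in> carrier A\<rbrakk> \<Longrightarrow> nm s x y \<in> carrier F"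
  by (simp_all add: basis_closed gens)

lemma op_closed: "\<lbrakk>x \<in> carrier A; y \<in> carrier A\<rbrakk> \<Longrightarrow> awb_op A s x y \<in> carrier A"
  by (rule awb_op_closed[OF awb_A])

lemma gen_val_closed: "g \<in> tensor_gens A A \<Longrightarrow> gen_val A (\<lambda>x. x) g \<in> carrier A"
  by (erule gens_cases) (simp_all add: op_closed)

lemma basic_pairs_self:
  "basic_pairs A A (self_action A) (self_action A) =
     {(a, a) | a. a \<in> {awb_op A s x y | s x y. x \<in> carrier A \<and> y \<in> carrier A}}"
  unfolding basic_pairs_def gen_fst_self_action gen_snd_self_action
  by (force elim!: gens_cases intro: gens)

lemma relators_cases:
  assumes "d \<in> tensor_relators K A A (self_action A) (self_action A)"
  obtains l r where "d = l \<ominus>\<^bsub>F\<^esub> r" "tensor_rel K F A A (self_action A) mn nm l r"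
  | l r where "d = l \<ominus>\<^bsub>F\<^esub> r" "tensor_rel K F A A (self_action A) nm mn l r"
  | s u v where "d = mn s u v \<ominus>\<^bsub>F\<^esub> nm s u v" "u \<in> carrier A" "v \<in> carrier A"
  using assms op_closed
  unfolding tensor_relators_def Let_def tensor_free_def basic_pairs_self by blast

lemma relators_closed: "tensor_relators K A A (self_action A) (self_action A) \<subseteq> carrier F"
proof
  fix d assume "d \<in> tensor_relators K A A (self_action A) (self_action A)"
  then show "d \<in> carrier F"
  proof (cases rule: relators_cases)
    case (1 l r)
    then show ?thesis
      using tensor_rel_closed[OF awb_A F.module_axioms mn_closed nm_closed 1(2)] by simp
  next
    case (2 l r)
    then show ?thesis
      using tensor_rel_closed[OF awb_A F.module_axioms nm_closed mn_closed 2(2)] by simp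
  qed (simp add: mn_closed nm_closed)
qed

lemma R_submodule: "submodule R K F"
  unfolding tensor_relspace_def tensor_free_def
  by (rule submodule_hull[OF F.module_axioms relators_closed])

sublocale quotient_module K F R T
proof (rule quotient_module.intro[OF F.module_axioms R_submodule], unfold_locales)
qed (simp_all add: tensor_square_def nonabelian_tensor_def tensor_free_def Let_def)

lemma cls_tensor_rel:
  "tensor_rel K F A A (self_action A) mn nm l r \<Longrightarrow> cls l = cls r"
  "tensor_rel K F A A (self_action A) nm mn l r \<Longrightarrow> cls l = cls r"
proof -
  have inR: "d \<in> R" if "d \<in> tensor_relators K A A (self_action A) (self_action A)" for d
    unfolding tensor_relspace_def using that by (rule hull_inc)
  show "cls l = cls r" if rel: "tensor_rel K F A A (self_action A) mn nm l r"
  proof -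
    have "l \<ominus>\<^bsub>F\<^esub> r \<in> R"
      by (rule inR) (use rel in \<open>auto simp: tensor_relators_def tensor_free_def Let_def\<close>)
    then show ?thesis
      using tensor_rel_closed[OF awb_A F.module_axioms mn_closed nm_closed rel]
      by (simp add: cls_eq_iff)
  qed
  show "cls l = cls r" if rel: "tensor_rel K F A A (self_action A) nm mn l r"
  proof -
    have "l \<ominus>\<^bsub>F\<^esub> r \<in> R"
      by (rule inR) (use rel in \<open>auto simp: tensor_relators_def tensor_free_def Let_def\<close>)
    then show ?thesis
      using tensor_rel_closed[OF awb_A F.module_axioms nm_closed mn_closed rel]
      by (simp add: cls_eq_iff)
  qed
qed

lemma cls_basic:
  assumes "x \<in> carrier A" "y \<in> carrier A" "z \<in> carrier A" "w \<in> carrier A"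
  shows "cls (mn s (awb_op A t x y) (awb_op A t' z w)) = cls (nm s (awb_op A t x y) (awb_op A t' z w))"
proof -
  have "mn s (awb_op A t x y) (awb_op A t' z w) \<ominus>\<^bsub>F\<^esub> nm s (awb_op A t x y) (awb_op A t' z w) \<in> R"
    unfolding tensor_relspace_def tensor_relators_def tensor_free_def Let_def basic_pairs_self
    using assms by (intro hull_inc UnI2) blast
  then show ?thesis using assms by (simp add: cls_eq_iff mn_closed nm_closed op_closed)
qed

lemma cls_mn_linear_left:
  "y \<in> carrier A \<Longrightarrow> (\<lambda>x. cls (mn s x y)) \<in> linear_maps K A T"
  using cls_tensor_rel(1)[OF tensor_rel.smult_left] cls_tensor_rel(1)[OF tensor_rel.add_left]
  by (intro linear_mapsI) (simp_all add: cls_closed mn_closed add_cls smult_cls)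

lemma cls_mn_linear_right:
  "x \<in> carrier A \<Longrightarrow> (\<lambda>y. cls (mn s x y)) \<in> linear_maps K A T"
  using cls_tensor_rel(1)[OF tensor_rel.smult_right] cls_tensor_rel(1)[OF tensor_rel.add_right]
  by (intro linear_mapsI) (simp_all add: cls_closed mn_closed add_cls smult_cls)

lemma cls_nm_linear_left:
  "y \<in> carrier A \<Longrightarrow> (\<lambda>x. cls (nm s x y)) \<in> linear_maps K A T"
  using cls_tensor_rel(2)[OF tensor_rel.smult_left] cls_tensor_rel(2)[OF tensor_rel.add_left]
  by (intro linear_mapsI) (simp_all add: cls_closed nm_closed add_cls smult_cls)

lemma cls_nm_linear_right:
  "x \<in> carrier A \<Longrightarrow> (\<lambda>y. cls (nm s x y)) \<in> linear_maps K A T"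
  using cls_tensor_rel(2)[OF tensor_rel.smult_right] cls_tensor_rel(2)[OF tensor_rel.add_right]
  by (intro linear_mapsI) (simp_all add: cls_closed nm_closed add_cls smult_cls)

lemma cls_mn_mult:
  assumes "x \<in> carrier A" "y \<in> carrier A" "z \<in> carrier A"
  shows "cls (mn Odot (x \<otimes>\<^bsub>A\<^esub> y) z) = cls (mn Odot x (y \<otimes>\<^bsub>A\<^esub> z))"
  using cls_tensor_rel(1)[OF tensor_rel.mult_odot[OF assms]] by simp

lemma cls_mn_oast_mult:
  assumes "x \<in> carrier A" "y \<in> carrier A" "z \<in> carrier A"
  shows "cls (mn Oast (x \<otimes>\<^bsub>A\<^esub> y) z) =
    cls (mn Odot x (bracket A y z)) \<oplus>\<^bsub>T\<^esub> cls (nm Odot (bracket A x z) y)"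
  using cls_tensor_rel(1)[OF tensor_rel.mult_oast[OF assms]] assms
    op_closed[of _ _ Oast]
  by (simp add: add_cls mn_closed nm_closed)

section \<open>Maps out of the tensor square\<close>

text \<open>
  Zero is taken on the relations of each copy by \<open>tensor_rel_lift\<close>, and on those that identify the two copies because
  \<open>gen_val\<close> does not distinguish them.
\<close>

lemma lift_relspace_zero:
  assumes lift: "central_lift K A C \<chi> \<sigma>" and p: "p \<in> R"
  shows "lin_ext K C (gen_val C \<sigma>) p = \<zero>\<^bsub>C\<^esub>"
proof -
  interpret L: central_lift K A C \<chi> \<sigma> by fact
  let ?f = "lin_ext K C (gen_val C \<sigma>)"
  have val: "gen_val C \<sigma> \<in> tensor_gens A A \<rightarrow> carrier C"
    by (auto elim!: gens_cases simp: awb_op_closed[OF L.awb_C] L.\<sigma>_closed)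
  note f = lin_ext_linear[OF L.C.module_axioms val]
  have f_gen: "?f (mn s x y) = awb_op C s (\<sigma> x) (\<sigma> y)" "?f (nm s x y) = awb_op C s (\<sigma> x) (\<sigma> y)"
    if "x \<in> carrier A" "y \<in> carrier A" for s x y
    using that by (simp_all add: lin_ext_basis_vec[OF L.C.module_axioms]
        awb_op_closed[OF L.awb_C] L.\<sigma>_closed)
  have minus: "?f (l \<ominus>\<^bsub>F\<^esub> r) = \<zero>\<^bsub>C\<^esub>" if "l \<in> carrier F" "r \<in> carrier F" "?f l = ?f r" for l r
    using that linear_map_minus[OF F.module_axioms L.C.module_axioms f that(1,2)]
      linear_mapsD(1)[OF f] by (simp add: a_minus_def L.C.r_neg)
  have "R \<subseteq> {p \<in> carrier F. ?f p = \<zero>\<^bsub>C\<^esub>}"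
    unfolding tensor_relspace_def tensor_free_def
  proof (rule hull_minimal)
    show "submodule {p \<in> carrier F. ?f p = \<zero>\<^bsub>C\<^esub>} K F"
      by (rule equalizer_submodule[OF F.module_axioms L.C.module_axioms f
            zero_linear[OF L.C.module_axioms]])
    show "tensor_relators K A A (self_action A) (self_action A) \<subseteq> {p \<in> carrier F. ?f p = \<zero>\<^bsub>C\<^esub>}"
    proof
      fix d assume d: "d \<in> tensor_relators K A A (self_action A) (self_action A)"
      then have "?f d = \<zero>\<^bsub>C\<^esub>"
      proof (cases rule: relators_cases)
        case (1 l r)
        then show ?thesis
          using tensor_rel_closed[OF awb_A F.module_axioms mn_closed nm_closed 1(2)]
            L.tensor_rel_lift[OF F.module_axioms f mn_closed nm_closed f_gen 1(2)]
          by (simp add: minus)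
      next
        case (2 l r)
        then show ?thesis
          using tensor_rel_closed[OF awb_A F.module_axioms nm_closed mn_closed 2(2)]
            L.tensor_rel_lift[OF F.module_axioms f nm_closed mn_closed f_gen(2,1) 2(2)]
          by (simp add: minus)
      next
        case (3 s u v)
        then show ?thesis by (simp add: minus mn_closed nm_closed f_gen)
      qed
      then show "d \<in> {p \<in> carrier F. ?f p = \<zero>\<^bsub>C\<^esub>}" using d relators_closed by blast
    qed
  qed
  then show ?thesis using p by blast
qed

text \<open>
  As with \<^const>\<open>tensor_psi\<close>, the value is only meaningful where the linear extension is constant on cosets,
  such as for \<open>C\<close> and \<open>\<sigma>\<close> as in the preceding lemma.
\<close>

definition lift_map :: "('k, 'c) awb \<Rightarrow> ('a \<Rightarrow> 'c) \<Rightarrow> (('a, 'a) tensor_gen \<Rightarrow> 'k) set \<Rightarrow> 'c" where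
  "lift_map C \<sigma> U = the_elem (lin_ext K C (gen_val C \<sigma>) ` U)"

lemma
  assumes lift: "central_lift K A C \<chi> \<sigma>"
  shows lift_map_linear: "lift_map C \<sigma> \<in> linear_maps K T C"
    and lift_map_cls: "p \<in> carrier F \<Longrightarrow> lift_map C \<sigma> (cls p) = lin_ext K C (gen_val C \<sigma>) p"
    and lift_map_mn: "\<lbrakk>x \<in> carrier A; y \<in> carrier A\<rbrakk> \<Longrightarrow>
      lift_map C \<sigma> (cls (mn s x y)) = awb_op C s (\<sigma> x) (\<sigma> y)"
    and lift_map_nm: "\<lbrakk>x \<in> carrier A; y \<in> carrier A\<rbrakk> \<Longrightarrow>
      lift_map C \<sigma> (cls (nm s x y)) = awb_op C s (\<sigma> x) (\<sigma> y)"
proof -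
  interpret L: central_lift K A C \<chi> \<sigma> by fact
  have val: "gen_val C \<sigma> \<in> tensor_gens A A \<rightarrow> carrier C"
    by (auto elim!: gens_cases simp: awb_op_closed[OF L.awb_C] L.\<sigma>_closed)
  note f = lin_ext_linear[OF L.C.module_axioms val]
  note zero = lift_relspace_zero[OF lift]
  show "lift_map C \<sigma> \<in> linear_maps K T C"
    using factor_linear[OF L.C.module_axioms f zero] by (simp add: lift_map_def[abs_def])
  show cls: "lift_map C \<sigma> (cls p) = lin_ext K C (gen_val C \<sigma>) p" if "p \<in> carrier F" for p
    using factor_cls[OF L.C.module_axioms f zero that] by (simp add: lift_map_def)
  show "lift_map C \<sigma> (cls (mn s x y)) = awb_op C s (\<sigma> x) (\<sigma> y)"
    "lift_map C \<sigma> (cls (nm s x y)) = awb_op C s (\<sigma> x) (\<sigma> y)"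
    if "x \<in> carrier A" "y \<in> carrier A"
    using that by (simp_all add: cls mn_closed nm_closed lin_ext_basis_vec[OF L.C.module_axioms]
        awb_op_closed[OF L.awb_C] L.\<sigma>_closed)
qed

text \<open>
  The facts about \<open>\<psi>\<^sub>A\<close> are those about lifts, specialised to the trivial extension.
\<close>

lemma psi_lift_map: "psi K A = lift_map A (\<lambda>x. x)"
  by (rule ext) (simp add: psi_def tensor_psi_def lift_map_def gen_fst_self_action)

lemmas psi_linear = lift_map_linear[OF identity_central_lift[OF awb_A], folded psi_lift_map]
  and psi_cls = lift_map_cls[OF identity_central_lift[OF awb_A], folded psi_lift_map]
  and psi_mn = lift_map_mn[OF identity_central_lift[OF awb_A], folded psi_lift_map]
  and psi_nm = lift_map_nm[OF identity_central_lift[OF awb_A], folded psi_lift_map]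

lemma psi_closed: "U \<in> carrier T \<Longrightarrow> psi K A U \<in> carrier A"
  by (rule linear_mapsD(1)[OF psi_linear])

section \<open>The tensor square as an algebra with bracket\<close>

lemma eval_linear: "eval_A \<in> linear_maps K F A"
  by (rule lin_ext_linear[OF A.module_axioms]) (simp add: gen_val_closed)

text \<open>
  On generators, the operation takes \<open>g\<close>, \<open>h\<close> to the symbol \<open>g\<^sub>M \<star> h\<^sub>N\<close> by definition. Modulo the relations
  the symbol is bilinear in its entries, so both sides are bilinear in \<open>p\<close>, \<open>q\<close> and agree on basis vectors.
\<close>

lemma cls_pre_op:
  assumes p: "p \<in> carrier F" and q: "q \<in> carrier F"
  shows "cls (tensor_pre_op K A A (self_action A) (self_action A) s p q)
      = cls (mn s (eval_A p) (eval_A q))"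
proof -
  let ?v = "gen_val A (\<lambda>x. x)"
  let ?in = "\<lambda>g. lin_ext K F (\<lambda>h. mn s (?v g) (?v h))"
  have eval_basis: "eval_A (basis_vec K g) = ?v g" if "g \<in> tensor_gens A A" for g
    using that by (simp add: lin_ext_basis_vec[OF A.module_axioms] gen_val_closed)
  have in_linear: "?in g \<in> linear_maps K F F" if "g \<in> tensor_gens A A" for g
    using that by (intro lin_ext_linear[OF F.module_axioms]) (simp add: mn_closed gen_val_closed)
  have in_cls: "cls (?in g q) = cls (mn s (?v g) (eval_A q))" if g: "g \<in> tensor_gens A A" for g
  proof (rule free_space_map_eqI[OF module_T _ _ _ q])
    show "(\<lambda>q. cls (?in g q)) \<in> linear_maps K F T"
      by (rule linear_maps_comp[OF cls_linear in_linear[OF g]])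
    show "(\<lambda>q. cls (mn s (?v g) (eval_A q))) \<in> linear_maps K F T"
      by (rule linear_maps_comp[OF cls_mn_linear_right eval_linear]) (simp add: gen_val_closed g)
    show "cls (?in g (basis_vec K h)) = cls (mn s (?v g) (eval_A (basis_vec K h)))"
      if "h \<in> tensor_gens A A" for h
      using g that
      by (simp add: eval_basis lin_ext_basis_vec[OF F.module_axioms] mn_closed gen_val_closed)
  qed
  have in_closed: "(\<lambda>g. ?in g q) \<in> tensor_gens A A \<rightarrow> carrier F"
    using linear_mapsD(1)[OF in_linear q] by blast
  note out_linear = lin_ext_linear[OF F.module_axioms in_closed]
  have pre_op: "tensor_pre_op K A A (self_action A) (self_action A) s p q
      = lin_ext K F (\<lambda>g. ?in g q) p"
    by (simp add: tensor_pre_op_def tensor_free_def Let_def gen_fst_self_action gen_snd_self_action)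
  show "cls (tensor_pre_op K A A (self_action A) (self_action A) s p q)
      = cls (mn s (eval_A p) (eval_A q))"
    unfolding pre_op
  proof (rule free_space_map_eqI[OF module_T _ _ _ p])
    show "(\<lambda>p. cls (lin_ext K F (\<lambda>g. ?in g q) p)) \<in> linear_maps K F T"
      by (rule linear_maps_comp[OF cls_linear out_linear])
    show "(\<lambda>p. cls (mn s (eval_A p) (eval_A q))) \<in> linear_maps K F T"
      by (rule linear_maps_comp[OF cls_mn_linear_left eval_linear])
        (rule linear_mapsD(1)[OF eval_linear q])
    show "cls (lin_ext K F (\<lambda>g. ?in g q) (basis_vec K g))
        = cls (mn s (eval_A (basis_vec K g)) (eval_A q))"
      if g: "g \<in> tensor_gens A A" for g
    proof -
      have "lin_ext K F (\<lambda>g. ?in g q) (basis_vec K g) = ?in g q"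
        by (rule lin_ext_basis_vec[OF F.module_axioms]) (use in_closed g in blast)
      then show ?thesis using in_cls[OF g] eval_basis[OF g] by simp
    qed
  qed
qed

text \<open>
  The operations factor through \<open>\<psi>\<close>. The right-hand side no longer mentions representatives, which shows that
  the unions defining the operations are unions of a single coset.
\<close>

lemma op_T:
  assumes "U \<in> carrier T" "V \<in> carrier T"
  shows "awb_op T s U V = cls (mn s (psi K A U) (psi K A V))"
proof -
  obtain p q where p: "p \<in> carrier F" "U = cls p" and q: "q \<in> carrier F" "V = cls q"
    using assms by (metis T_cases)
  let ?op = "tensor_pre_op K A A (self_action A) (self_action A) s"
  have "awb_op T s U V = (\<Union>p\<in>U. \<Union>q\<in>V. cls (?op p q))"
    by (cases s) (simp_all add: tensor_square_def nonabelian_tensor_def tensor_free_def Let_def)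
  also have "\<dots> = (\<Union>p'\<in>cls p. \<Union>q'\<in>cls q. cls (mn s (psi K A U) (psi K A V)))"
    unfolding p(2) q(2)
  proof (intro SUP_cong refl)
    fix p' q' assume p': "p' \<in> cls p" and q': "q' \<in> cls q"
    then have "p' \<in> carrier F" "q' \<in> carrier F" using p(1) q(1) by (auto simp: mem_cls_iff)
    moreover have "cls p' = cls p" "cls q' = cls q" using p' q' p(1) q(1) cls_eqI by blast+
    ultimately show "cls (?op p' q') = cls (mn s (psi K A (cls p)) (psi K A (cls q)))"
      using cls_pre_op[of p' q' s] psi_cls[of p'] psi_cls[of q'] by simp
  qed
  also have "\<dots> = cls (mn s (psi K A U) (psi K A V))"
    using AR.a_rcos_self[OF p(1)] AR.a_rcos_self[OF q(1)] by blast
  finally show ?thesis .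
qed

lemma psi_op:
  "\<lbrakk>U \<in> carrier T; V \<in> carrier T\<rbrakk> \<Longrightarrow>
    psi K A (awb_op T s U V) = awb_op A s (psi K A U) (psi K A V)"
  by (simp add: op_T psi_mn psi_closed)

text \<open>
  The relations identify the symbols of the two copies only for products and brackets. The set of
  elements for which they agree is a subspace, so it is everything by perfectness; this is applied first to
  the left entry and then to the right one.
\<close>

lemma cls_nm_eq_mn:
  assumes perfect: "perfect_awb K A" and u: "u \<in> carrier A" and v: "v \<in> carrier A"
  shows "cls (nm s u v) = cls (mn s u v)"
proof -
  have v_op: "cls (nm s u (awb_op A t x y)) = cls (mn s u (awb_op A t x y))"
    if "x \<in> carrier A" "y \<in> carrier A" "u \<in> carrier A" for t x y u
  proof -
    have "carrier A \<subseteq> {u \<in> carrier A. cls (nm s u (awb_op A t x y)) = cls (mn s u (awb_op A t x y))}"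
      by (rule perfect_awb_span[OF awb_A perfect equalizer_submodule[OF A.module_axioms module_T
            cls_nm_linear_left cls_mn_linear_left]])
        (use that cls_basic in \<open>auto simp: op_closed\<close>)
    then show ?thesis using that by blast
  qed
  have "carrier A \<subseteq> {v \<in> carrier A. cls (nm s u v) = cls (mn s u v)}"
    by (rule perfect_awb_span[OF awb_A perfect equalizer_submodule[OF A.module_axioms module_T
          cls_nm_linear_right cls_mn_linear_right]])
      (use u v_op in \<open>auto simp: op_closed\<close>)
  then show ?thesis using v by blast
qed

text \<open>
  Each law holds because both sides are, by \<open>op_T\<close>, classes of symbols in \<open>\<psi> U\<close>, \<open>\<psi> V\<close>, \<open>\<psi> W\<close> that a relation
  identifies. The bracket law also needs the previous lemma, since expanding \<open>x y \<circledast> z\<close> produces a symbol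
  of the other copy.
\<close>

lemma awb_T:
  assumes perfect: "perfect_awb K A"
  shows "awb K T"
proof -
  interpret T: module K T by (rule module_T)
  have linear_left: "(\<lambda>U. awb_op T s U V) \<in> linear_maps K T T" if V: "V \<in> carrier T" for s V
    using linear_maps_comp[OF cls_mn_linear_left[OF psi_closed[OF V], of s] psi_linear] V
    by (auto simp: linear_maps_def op_T)
  have linear_right: "awb_op T s V \<in> linear_maps K T T" if V: "V \<in> carrier T" for s V
    using linear_maps_comp[OF cls_mn_linear_right[OF psi_closed[OF V], of s] psi_linear] V
    by (auto simp: linear_maps_def op_T)
  note bilinear = bilinear_opI[OF linear_left linear_right]
  have closed: "awb_op T s U V \<in> carrier T" if "U \<in> carrier T" "V \<in> carrier T" for s U V
    using that by (simp add: op_T cls_closed mn_closed psi_closed)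
  note odot = op_T[of _ _ Odot, simplified] and oast = op_T[of _ _ Oast, simplified]
    and closed' = closed[of _ _ Odot, simplified] closed[of _ _ Oast, simplified]
    and psi' = psi_op[of _ _ Odot, simplified] psi_op[of _ _ Oast, simplified]
    and A_op = op_closed[of _ _ Odot, simplified] op_closed[of _ _ Oast, simplified]
  show ?thesis
  proof (intro awb.intro awb_axioms.intro)
    show "field K" using awb_A by (simp add: awb_def)
    show "module K T" by (rule module_T)
    show "bilinear_op K T (\<otimes>\<^bsub>T\<^esub>)" "bilinear_op K T (bracket T)"
      using bilinear[of Odot] bilinear[of Oast] by (simp_all add: awb_op_def)
    fix U V W assume UVW: "U \<in> carrier T" "V \<in> carrier T" "W \<in> carrier T"
    note closedU = UVW psi_closed[OF UVW(1)] psi_closed[OF UVW(2)] psi_closed[OF UVW(3)]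
    have "(U \<otimes>\<^bsub>T\<^esub> V) \<otimes>\<^bsub>T\<^esub> W = cls (mn Odot (psi K A U \<otimes>\<^bsub>A\<^esub> psi K A V) (psi K A W))"
      using closedU by (subst odot) (simp_all add: closed' psi')
    also have "\<dots> = cls (mn Odot (psi K A U) (psi K A V \<otimes>\<^bsub>A\<^esub> psi K A W))"
      using closedU by (simp add: cls_mn_mult)
    also have "\<dots> = U \<otimes>\<^bsub>T\<^esub> (V \<otimes>\<^bsub>T\<^esub> W)"
      using closedU by (subst odot) (simp_all add: closed' psi')
    finally show "(U \<otimes>\<^bsub>T\<^esub> V) \<otimes>\<^bsub>T\<^esub> W = U \<otimes>\<^bsub>T\<^esub> (V \<otimes>\<^bsub>T\<^esub> W)" .
    have "bracket T (U \<otimes>\<^bsub>T\<^esub> V) W = cls (mn Oast (psi K A U \<otimes>\<^bsub>A\<^esub> psi K A V) (psi K A W))"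
      using closedU by (subst oast) (simp_all add: closed' psi')
    also have "\<dots> = cls (mn Odot (psi K A U) (bracket A (psi K A V) (psi K A W)))
        \<oplus>\<^bsub>T\<^esub> cls (mn Odot (bracket A (psi K A U) (psi K A W)) (psi K A V))"
      using closedU by (simp add: cls_mn_oast_mult cls_nm_eq_mn[OF perfect] A_op)
    also have "cls (mn Odot (psi K A U) (bracket A (psi K A V) (psi K A W))) = U \<otimes>\<^bsub>T\<^esub> bracket T V W"
      using closedU by (subst odot) (simp_all add: closed' psi')
    also have "cls (mn Odot (bracket A (psi K A U) (psi K A W)) (psi K A V)) = bracket T U W \<otimes>\<^bsub>T\<^esub> V"
      using closedU by (subst odot) (simp_all add: closed' psi')
    finally show "bracket T (U \<otimes>\<^bsub>T\<^esub> V) W = bracket T U W \<otimes>\<^bsub>T\<^esub> V \<oplus>\<^bsub>T\<^esub> U \<otimes>\<^bsub>T\<^esub> bracket T V W"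
      using closedU by (simp add: T.a_comm closed')
  qed
qed

lemma psi_surj:
  assumes perfect: "perfect_awb K A"
  shows "psi K A ` carrier T = carrier A"
proof
  show "psi K A ` carrier T \<subseteq> carrier A" using psi_closed by blast
  show "carrier A \<subseteq> psi K A ` carrier T"
  proof (rule perfect_awb_span[OF awb_A perfect image_submodule[OF module_T A.module_axioms psi_linear]])
    show "awb_op A s x y \<in> psi K A ` carrier T" if "x \<in> carrier A" "y \<in> carrier A" for s x y
      using that by (intro image_eqI[of _ _ "cls (mn s x y)"]) (simp_all add: psi_mn cls_closed mn_closed)
  qed
qed

section \<open>Universality\<close>

text \<open>
  The kernel is central because \<open>\<psi> U = 0\<close> makes one entry of the symbols representing \<open>U V\<close>, \<open>V U\<close>,
  \<open>[U, V]\<close> and \<open>[V, U]\<close> zero.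
\<close>

lemma psi_central_extension:
  assumes perfect: "perfect_awb K A"
  shows "central_extension K T A (psi K A)"
  unfolding central_extension_def
proof (intro conjI)
  show "awb K T" by (rule awb_T[OF perfect])
  show "awb K A" by (rule awb_A)
  show "psi K A \<in> awb_hom K T A" by (simp add: awb_hom_iff psi_linear psi_op)
  show "psi K A ` carrier T = carrier A" by (rule psi_surj[OF perfect])
  show "a_kernel T A (psi K A) \<subseteq> awb_center T"
  proof
    fix U assume "U \<in> a_kernel T A (psi K A)"
    then have U: "U \<in> carrier T" "psi K A U = \<zero>\<^bsub>A\<^esub>" by (auto simp: a_kernel_def kernel_def)
    have "awb_op T s U V = \<zero>\<^bsub>T\<^esub>" "awb_op T s V U = \<zero>\<^bsub>T\<^esub>" if V: "V \<in> carrier T" for s V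
      using op_T[OF U(1) V] op_T[OF V U(1)] U(2)
        linear_map_zero[OF A.module_axioms module_T cls_mn_linear_left[OF psi_closed[OF V]]]
        linear_map_zero[OF A.module_axioms module_T cls_mn_linear_right[OF psi_closed[OF V]]]
      by simp_all
    then show "U \<in> awb_center T" using U(1) by (auto simp: mem_awb_center_iff)
  qed
qed

lemma lift_map_over:
  assumes lift: "central_lift K A C \<chi> \<sigma>" and U: "U \<in> carrier T"
  shows "\<chi> (lift_map C \<sigma> U) = psi K A U"
proof -
  interpret L: central_lift K A C \<chi> \<sigma> by fact
  obtain p where p: "p \<in> carrier F" "U = cls p" using U by (rule T_cases)
  have "\<chi> (lift_map C \<sigma> (cls p)) = psi K A (cls p)"
  proof (rule free_space_map_eqI[OF A.module_axioms _ _ _ p(1)])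
    show "(\<lambda>p. \<chi> (lift_map C \<sigma> (cls p))) \<in> linear_maps K F A"
      by (rule linear_maps_comp[OF L.\<chi>_linear linear_maps_comp[OF lift_map_linear[OF lift] cls_linear]])
    show "(\<lambda>p. psi K A (cls p)) \<in> linear_maps K F A"
      by (rule linear_maps_comp[OF psi_linear cls_linear])
    show "\<chi> (lift_map C \<sigma> (cls (basis_vec K g))) = psi K A (cls (basis_vec K g))"
      if "g \<in> tensor_gens A A" for g
      using that
      by (rule gens_cases) (simp_all add: lift_map_mn[OF lift] lift_map_nm[OF lift] psi_mn psi_nm
          L.\<chi>_op L.\<sigma>_closed L.\<chi>_\<sigma>)
  qed
  then show ?thesis using p(2) by simp
qed

text \<open>
  The lift sends \<open>U V = \<psi> U \<odot> \<psi> V\<close> to the product of \<open>\<sigma> (\<psi> U)\<close> and \<open>\<sigma> (\<psi> V)\<close>. The image of \<open>U\<close> is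
  another element over \<open>\<psi> U\<close>, and likewise for \<open>V\<close>, so the product of the images is the same.
\<close>

lemma lift_map_hom:
  assumes lift: "central_lift K A C \<chi> \<sigma>"
  shows "lift_map C \<sigma> \<in> awb_hom K T C"
proof -
  interpret L: central_lift K A C \<chi> \<sigma> by fact
  note closed = linear_mapsD(1)[OF lift_map_linear[OF lift]]
  have "lift_map C \<sigma> (awb_op T s U V) = awb_op C s (lift_map C \<sigma> U) (lift_map C \<sigma> V)"
    if UV: "U \<in> carrier T" "V \<in> carrier T" for s U V
  proof -
    have "lift_map C \<sigma> (awb_op T s U V) = awb_op C s (\<sigma> (psi K A U)) (\<sigma> (psi K A V))"
      using UV by (simp add: op_T lift_map_mn[OF lift] psi_closed)
    also have "\<dots> = awb_op C s (lift_map C \<sigma> U) (lift_map C \<sigma> V)"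
      by (rule L.op_lift_indep)
        (use UV in \<open>simp_all add: closed L.\<sigma>_closed L.\<chi>_\<sigma> psi_closed lift_map_over[OF lift]\<close>)
    finally show ?thesis .
  qed
  then show ?thesis by (simp add: awb_hom_iff lift_map_linear[OF lift])
qed

text \<open>
  The values of \<open>\<alpha>\<close> and \<open>\<beta>\<close> lie over the same elements of \<open>A\<close>, so products and brackets of them coincide. This
  settles all generators, since \<open>x \<star> y\<close> is the product or bracket of preimages of \<open>x\<close> and \<open>y\<close>.
\<close>

lemma hom_over_unique:
  assumes perfect: "perfect_awb K A" and lift: "central_lift K A C \<chi> \<sigma>"
    and \<alpha>: "\<alpha> \<in> awb_hom K T C" "\<And>U. U \<in> carrier T \<Longrightarrow> \<chi> (\<alpha> U) = psi K A U"
    and \<beta>: "\<beta> \<in> awb_hom K T C" "\<And>U. U \<in> carrier T \<Longrightarrow> \<chi> (\<beta> U) = psi K A U"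
    and U: "U \<in> carrier T"
  shows "\<alpha> U = \<beta> U"
proof -
  interpret L: central_lift K A C \<chi> \<sigma> by fact
  have lin: "\<alpha> \<in> linear_maps K T C" "\<beta> \<in> linear_maps K T C"
    using \<alpha>(1) \<beta>(1) by (simp_all add: awb_hom_iff)
  have on_ops: "\<alpha> (awb_op T s X Y) = \<beta> (awb_op T s X Y)"
    if "X \<in> carrier T" "Y \<in> carrier T" for s X Y
  proof -
    have "awb_op C s (\<alpha> X) (\<alpha> Y) = awb_op C s (\<beta> X) (\<beta> Y)"
      by (rule L.op_lift_indep) (use that linear_mapsD(1)[OF lin(1)] linear_mapsD(1)[OF lin(2)]
          \<alpha>(2) \<beta>(2) in auto)
    then show ?thesis using that \<alpha>(1) \<beta>(1) by (simp add: awb_hom_iff)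
  qed
  have on_mn: "\<alpha> (cls (mn s x y)) = \<beta> (cls (mn s x y))" if xy: "x \<in> carrier A" "y \<in> carrier A" for s x y
  proof -
    have "x \<in> psi K A ` carrier T" "y \<in> psi K A ` carrier T"
      using xy by (simp_all only: psi_surj[OF perfect])
    then obtain X Y where "X \<in> carrier T" "x = psi K A X" "Y \<in> carrier T" "y = psi K A Y"
      by (elim imageE)
    then show ?thesis using on_ops[of X Y s] by (simp add: op_T)
  qed
  obtain p where p: "p \<in> carrier F" "U = cls p" using U by (rule T_cases)
  have "\<alpha> (cls p) = \<beta> (cls p)"
  proof (rule free_space_map_eqI[OF L.C.module_axioms _ _ _ p(1)])
    show "(\<lambda>p. \<alpha> (cls p)) \<in> linear_maps K F C" "(\<lambda>p. \<beta> (cls p)) \<in> linear_maps K F C"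
      by (rule linear_maps_comp[OF lin(1) cls_linear], rule linear_maps_comp[OF lin(2) cls_linear])
    show "\<alpha> (cls (basis_vec K g)) = \<beta> (cls (basis_vec K g))" if "g \<in> tensor_gens A A" for g
      using that by (rule gens_cases) (simp_all add: on_mn cls_nm_eq_mn[OF perfect])
  qed
  then show ?thesis using p(2) by simp
qed

end

theorem theorem4p8:
  fixes K :: "('k, 'e) ring_scheme" and A :: "('k, 'a) awb"
  assumes "awb K A" and "perfect_awb K A"
  shows "universal_central_extension TYPE('c) K (tensor_square K A) A (psi K A)"
proof -
  interpret awb_square K A by (rule awb_square.intro) fact
  show ?thesis
    unfolding universal_central_extension_def
  proof (intro conjI allI impI)
    show "central_extension K T A (psi K A)" by (rule psi_central_extension[OF assms(2)])
    fix C :: "('k, 'c) awb" and \<chi>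
    assume ext: "central_extension K C A \<chi>"
    define \<sigma> where "\<sigma> = inv_into (carrier C) \<chi>"
    have surj: "carrier A = \<chi> ` carrier C" using ext by (simp add: central_extension_def)
    have lift: "central_lift K A C \<chi> \<sigma>"
      by (rule central_lift.intro) (simp_all add: ext \<sigma>_def surj inv_into_into f_inv_into_f)
    let ?\<alpha> = "restrict (lift_map C \<sigma>) (carrier T)"
    have restrict_hom: "?\<alpha> \<in> awb_hom K T C"
      by (rule restrict_awb_hom[OF awb_T[OF assms(2)] lift_map_hom[OF lift]])
    show "\<exists>!\<alpha>. \<alpha> \<in> awb_hom K T C \<inter> extensional (carrier T) \<and>
        (\<forall>U\<in>carrier T. \<chi> (\<alpha> U) = psi K A U)"
    proof (rule ex1I[of _ ?\<alpha>])
      show "?\<alpha> \<in> awb_hom K T C \<inter> extensional (carrier T) \<and>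
          (\<forall>U\<in>carrier T. \<chi> (?\<alpha> U) = psi K A U)"
        using restrict_hom by (simp add: lift_map_over[OF lift])
      fix \<alpha> assume \<alpha>: "\<alpha> \<in> awb_hom K T C \<inter> extensional (carrier T) \<and>
          (\<forall>U\<in>carrier T. \<chi> (\<alpha> U) = psi K A U)"
      show "\<alpha> = ?\<alpha>"
      proof (rule extensionalityI)
        show "\<alpha> U = ?\<alpha> U" if "U \<in> carrier T" for U
          using hom_over_unique[OF assms(2) lift _ _ restrict_hom _ that, of \<alpha>] \<alpha>
          by (simp add: lift_map_over[OF lift])
      qed (use \<alpha> in auto)
    qed
  qed
qed

end
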